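(* Let $\mathcal{G}=\langle a,b,c,d\rangle$ be the group of automorphisms of the rooted binary tree defined in the context, let $d(H)$ denote the minimal number of generators of a group $H$, and let $\log$ denote the logarithm with base $2$. The group $\mathcal{G}$ is normally $(f,g)$-$RG$-rigid (as defined in the context) with $$f(n)=\log\log(n),\qquad g(n)=\log(n).$$ Moreover, there is a constant $D>1$ such that $$\frac{1}{D}\log(d(H))\leq \log\log([\mathcal{G}:H])\leq D\log(d(H))$$ holds for every nontrivial normal subgroup $H\lhd\mathcal{G}$.
   Context: The vertices of the rooted binary tree $\mathcal{T}$ are the finite words over $\{0,1\}$ (the root is the empty word; the children of $w$ are $w0,w1$). $\mathcal{G}$ is the group generated, under composition, by the tree automorphisms $a,b,c,d$ fixing the empty word and given recursively, for all $w\in\{0,1\}^*$, by $a(0w)=1w$, $a(1w)=0w$; $b(0w)=0a(w)$, $b(1w)=1c(w)$; $c(0w)=0a(w)$, $c(1w)=1d(w)$; $d(0w)=0w$, $d(1w)=1b(w)$. All nontrivial normal subgroups of $\mathcal{G}$ have finite index, since $\mathcal{G}$ is just-infinite (infinite, with every proper quotient finite). Definition: let $f(n),g(n)$ be two increasing functions of natural argument $n$ taking values in $\mathbb{N}$ and having limit $\infty$ as $n\to\infty$. A finitely generated group $G$ is $(f,g)$-$RG$-rigid if there is $C\in\mathbb{N}$ such that for every subgroup $H<G$ of finite index $$g(d(H))<C f(C[G:H])\quad\text{and}\quad f([G:H])<C g(C d(H)).$$ $G$ is normally $(f,g)$-$RG$-rigid if these inequalities hold for each normal subgroup $H\lhd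 G$ of finite index.
   Formalization: The inequality (1/D)log(d(H)) ≤ loglog([G:H]) is claimed only for [G:H] > 2: at index 2 it is false, since loglog 2 = 0 while d(H) ≥ 2, and for H = G the term loglog 1 is undefined (taken as 0 in the formal statement). *)

theory Defs
  imports "HOL-Analysis.Analysis" "HOL-Algebra.Algebra"
begin

section \<open>The Grigorchuk group\<close>

text \<open>
  A vertex of the rooted binary tree is a word over the letters 0 and 1, encoded as a
  \<^typ>\<open>bool list\<close> with 0 as \<^term>\<open>False\<close> and 1 as \<^term>\<open>True\<close>.
\<close>

fun gen_a :: "bool list \<Rightarrow> bool list" where
  "gen_a [] = []"
| "gen_a (False # w) = True # w"
| "gen_a (True # w) = False # w"

fun gen_b gen_c gen_d :: "bool list \<Rightarrow> bool list" where
  "gen_b [] = []"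
| "gen_b (False # w) = False # gen_a w"
| "gen_b (True # w) = True # gen_c w"
| "gen_c [] = []"
| "gen_c (False # w) = False # gen_a w"
| "gen_c (True # w) = True # gen_d w"
| "gen_d [] = []"
| "gen_d (False # w) = False # w"
| "gen_d (True # w) = True # gen_b w"

text \<open>
  The four generators preserve lengths and prefixes, so generating inside the symmetric group
  of the vertex set gives the same group as generating inside the automorphism group of the tree.
\<close>

definition grigorchuk_group :: "(bool list \<Rightarrow> bool list) monoid" where
  "grigorchuk_group =
     (BijGroup UNIV)\<lparr>carrier := generate (BijGroup UNIV) {gen_a, gen_b, gen_c, gen_d}\<rparr>"

lemma gen_a_gen_a: "gen_a (gen_a w) = w"
  by (cases w rule: gen_a.cases) auto

lemma gen_bcd_involutions:
  "gen_b (gen_b w) = w" "gen_c (gen_c w) = w" "gen_d (gen_d w) = w"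
  by (induction w and w and w rule: gen_b_gen_c_gen_d.induct) (auto simp: gen_a_gen_a)

lemma gens_in_BijGroup: "{gen_a, gen_b, gen_c, gen_d} \<subseteq> carrier (BijGroup UNIV)"
  using involuntory_imp_bij[of gen_a] involuntory_imp_bij[of gen_b]
    involuntory_imp_bij[of gen_c] involuntory_imp_bij[of gen_d]
  by (simp add: BijGroup_def Bij_def gen_a_gen_a gen_bcd_involutions)

lemma group_grigorchuk_group: "group grigorchuk_group"
  unfolding grigorchuk_group_def
  by (intro subgroup.subgroup_is_group group.generate_is_subgroup group_BijGroup gens_in_BijGroup)

section \<open>Rank, index and rigidity\<close>

definition finitely_generated_group :: "('a, 'b) monoid_scheme \<Rightarrow> bool" where
  "finitely_generated_group G \<longleftrightarrow>
     group G \<and> (\<exists>S. finite S \<and> S \<subseteq> carrier G \<and> generate G S = carrier G)"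

text \<open>
  The minimal number of generators \<open>d(H)\<close> of a subgroup \<open>H\<close> of \<open>G\<close>.  It is meaningful only if
  \<open>H\<close> is finitely generated, as every subgroup of finite index in a finitely generated group is.
\<close>

definition min_generators :: "('a, 'b) monoid_scheme \<Rightarrow> 'a set \<Rightarrow> nat" where
  "min_generators G H = (LEAST n. \<exists>S. finite S \<and> card S = n \<and> S \<subseteq> H \<and> generate G S = H)"

definition finite_index :: "('a, 'b) monoid_scheme \<Rightarrow> 'a set \<Rightarrow> bool" where
  "finite_index G H \<longleftrightarrow> finite (rcosets\<^bsub>G\<^esub> H)"

text \<open>The index \<open>[G:H]\<close>, meaningful only under \<^const>\<open>finite_index\<close> (\<^const>\<open>card\<close> is 0 otherwise).\<close>

definition subgroup_index :: "('a, 'b) monoid_scheme \<Rightarrow> 'a set \<Rightarrow> nat" where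
  "subgroup_index G H = card (rcosets\<^bsub>G\<^esub> H)"

text \<open>
  The comparison functions are real-valued so that logarithms qualify without rounding;
  ``increasing'' is non-strict, because a strictly increasing function with natural values
  grows at least linearly and logarithms would be excluded.
\<close>

definition normally_RG_rigid ::
  "(nat \<Rightarrow> real) \<Rightarrow> (nat \<Rightarrow> real) \<Rightarrow> ('a, 'b) monoid_scheme \<Rightarrow> bool" where
  "normally_RG_rigid f g G \<longleftrightarrow>
     mono f \<and> mono g \<and> filterlim f at_top sequentially \<and> filterlim g at_top sequentially \<and>
     finitely_generated_group G \<and>
     (\<exists>C::nat. \<forall>H. H \<lhd> G \<and> finite_index G H \<longrightarrow>
        g (min_generators G H) < real C * f (C * subgroup_index G H) \<and>
        f (subgroup_index G H) < real C * g (C * min_generators G H))"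

end

(*
  Write t = (ab)^2 and let K be its normal closure.  K has index at most 16, and K contains the copy
  of itself acting below any vertex (G is regular branch over K).  Let H be a nontrivial normal
  subgroup and let n be maximal such that H fixes level n.  An element of H that moves a vertex of
  level n + 1, commuted with elements of K acting below that vertex, shows that H contains the copies
  of K below all vertices of level n + 3.  As the product of these copies has index at most
  2^(5 * 2^(n+3)) in G, this bounds both [G:H] and d(H) from above.  As H fixes level n, the
  2^(2^(n-2)) products of copies of t below level n - 2 lie in different cosets of H.

  It remains to show that d(H) = r is at least exponential in n.  H acts on level n + 5 as a 2-group with orbits of
  length at most 32 = 2^5, so on the functions on this level with values in the field of two
  elements every product of 32 operators g - 1 vanishes.  Expanding g = 1 + (g - 1), each element
  of H acts as a sum of products of fewer than 32 operators taken from a list of at most 2r, so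
  there are at most 2^((2r+1)^32) actions.  On the other hand, the copies of t below level n + 3
  produce 2^(2^(n+3)) of them.
*)

theory Submission
  imports Defs "HOL-Library.Z2" "HOL-Library.Function_Algebras"
begin

section \<open>Elements of the group as tree automorphisms\<close>

abbreviation finv :: "('a \<Rightarrow> 'b) \<Rightarrow> 'b \<Rightarrow> 'a" where
  "finv f \<equiv> inv_into UNIV f"

abbreviation Grig :: "(bool list \<Rightarrow> bool list) set" where
  "Grig \<equiv> carrier grigorchuk_group"

abbreviation gens :: "(bool list \<Rightarrow> bool list) set" where
  "gens \<equiv> {gen_a, gen_b, gen_c, gen_d}"

interpretation grig: group grigorchuk_group
  by (rule group_grigorchuk_group)

section \<open>Group operations as composition and inversion of functions\<close>

lemma Grig_Bij: "Grig \<subseteq> Bij UNIV"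
  using group.generate_incl[OF group_BijGroup gens_in_BijGroup]
  by (simp add: grigorchuk_group_def) (simp add: BijGroup_def)

lemma Grig_bij: "g \<in> Grig \<Longrightarrow> bij g"
  using Grig_Bij by (auto simp: Bij_def)

lemma Grig_mult [simp]:
  assumes "g \<in> Grig" "h \<in> Grig"
  shows "g \<otimes>\<^bsub>grigorchuk_group\<^esub> h = g \<circ> h"
proof -
  have "mult grigorchuk_group = mult (BijGroup UNIV)"
    by (simp add: grigorchuk_group_def)
  then show ?thesis
    using subsetD[OF Grig_Bij assms(1)] subsetD[OF Grig_Bij assms(2)]
    by (simp add: BijGroup_def compose_def comp_def fun_eq_iff)
qed

lemma Grig_one [simp]: "\<one>\<^bsub>grigorchuk_group\<^esub> = id"
proof -
  have "\<one>\<^bsub>grigorchuk_group\<^esub> = \<one>\<^bsub>BijGroup UNIV\<^esub>"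
    by (simp add: grigorchuk_group_def)
  then show ?thesis
    by (simp add: BijGroup_def fun_eq_iff)
qed

lemma Grig_id [simp, intro]: "id \<in> Grig"
  using grig.one_closed by simp

lemma Grig_comp [simp, intro]: "g \<in> Grig \<Longrightarrow> h \<in> Grig \<Longrightarrow> g \<circ> h \<in> Grig"
  using grig.m_closed[of g h] by simp

lemma Grig_inv [simp]:
  assumes "g \<in> Grig"
  shows "inv\<^bsub>grigorchuk_group\<^esub> g = finv g"
proof -
  have "g \<circ> inv\<^bsub>grigorchuk_group\<^esub> g = id"
    using grig.r_inv[OF assms] assms by simp
  then show ?thesis
    using Grig_bij[OF assms] by (metis bij_is_inj comp_id inv_o_cancel o_assoc id_comp)
qed

lemma Grig_inv_closed [simp, intro]: "g \<in> Grig \<Longrightarrow> finv g \<in> Grig"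
  using grig.inv_closed[of g] by simp

lemma gens_Grig: "gens \<subseteq> Grig"
  by (auto simp: grigorchuk_group_def intro: generate.incl)

lemma generate_gens: "generate grigorchuk_group gens = Grig"
  unfolding grigorchuk_group_def
  by (simp add: group.generate_consistent[OF group_BijGroup] generate.incl subset_iff
      group.generate_is_subgroup[OF group_BijGroup gens_in_BijGroup])

lemma gens_involution: "x \<in> gens \<Longrightarrow> x \<circ> x = id"
  by (auto simp: fun_eq_iff gen_a_gen_a gen_bcd_involutions)

lemma gens_inv: "x \<in> gens \<Longrightarrow> finv x = x"
  using gens_involution by (metis inv_unique_comp)

text \<open>The generators are involutions, so the inverse of a generator is a generator and no case
  for inverses arises.\<close>

lemma Grig_induct [consumes 1, case_names id gen comp]:
  assumes "g \<in> Grig" and "P id" and "\<And>x. x \<in> gens \<Longrightarrow> P x"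
    and "\<And>g h. g \<in> Grig \<Longrightarrow> h \<in> Grig \<Longrightarrow> P g \<Longrightarrow> P h \<Longrightarrow> P (g \<circ> h)"
  shows "P g"
proof -
  have "g \<in> generate grigorchuk_group gens"
    using assms(1) by (simp add: generate_gens)
  then show ?thesis
  proof induction
    case one
    show ?case
      using assms(2) by (simp only: Grig_one)
  next
    case (incl x)
    then show ?case
      by (rule assms(3))
  next
    case (inv x)
    then have "x \<in> Grig"
      using gens_Grig by blast
    then show ?case
      using assms(3)[OF inv] gens_inv[OF inv] by (simp only: Grig_inv)
  next
    case (eng g h)
    then have "g \<in> Grig" "h \<in> Grig"
      by (simp_all only: generate_gens)
    then show ?case
      using assms(4)[OF _ _ eng.IH] by (simp only: Grig_mult)
  qed
qed

lemma subgroup_Grig_iff: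
  "subgroup H grigorchuk_group \<longleftrightarrow>
     H \<subseteq> Grig \<and> id \<in> H \<and> (\<forall>x\<in>H. \<forall>y\<in>H. x \<circ> y \<in> H) \<and> (\<forall>x\<in>H. finv x \<in> H)"
  (is "?L = ?R")
proof
  assume ?L
  then interpret subgroup H grigorchuk_group .
  have "x \<circ> y \<in> H" if "x \<in> H" "y \<in> H" for x y
    using m_closed[OF that] that[THEN mem_carrier] by (simp only: Grig_mult)
  moreover have "finv x \<in> H" if "x \<in> H" for x
    using m_inv_closed[OF that] mem_carrier[OF that] by (simp only: Grig_inv)
  ultimately show ?R
    using subset one_closed by (simp only: Grig_one) blast
next
  assume ?R
  then have "x \<in> H \<Longrightarrow> x \<in> Grig" for x by blast
  then show ?L
    using \<open>?R\<close> by (intro subgroup.intro) (simp_all only: Grig_mult Grig_one Grig_inv)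
qed

lemma normal_Grig_iff:
  "H \<lhd> grigorchuk_group \<longleftrightarrow>
     subgroup H grigorchuk_group \<and> (\<forall>g\<in>Grig. \<forall>h\<in>H. g \<circ> h \<circ> finv g \<in> H)"
proof -
  have "g \<otimes>\<^bsub>grigorchuk_group\<^esub> h \<otimes>\<^bsub>grigorchuk_group\<^esub> inv\<^bsub>grigorchuk_group\<^esub> g = g \<circ> h \<circ> finv g"
    if "g \<in> Grig" "h \<in> Grig" for g h
    using that by (simp only: Grig_mult Grig_inv Grig_comp Grig_inv_closed)
  then show ?thesis
    unfolding grig.normal_inv_iff using subgroup.mem_carrier[of H grigorchuk_group]
    by (intro conj_cong refl) simp
qed

section \<open>Levels, sections and lifts\<close>

lemma Grig_length: "g \<in> Grig \<Longrightarrow> length (g v) = length v"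
proof (induction arbitrary: v rule: Grig_induct)
  case (gen x)
  have a: "length (gen_a v) = length v" for v
    by (cases v rule: gen_a.cases) simp_all
  have "length (gen_b v) = length v \<and> length (gen_c v) = length v \<and> length (gen_d v) = length v" for v
  proof (induction v)
    case (Cons b v)
    then show ?case by (cases b) (simp_all add: a)
  qed auto
  with a gen show ?case by blast
qed simp_all

lemma Grig_Nil: "g \<in> Grig \<Longrightarrow> g [] = []"
  using Grig_length[of g "[]"] by (metis length_0_conv)

lemma gen_a_Cons [simp]: "gen_a (b # v) = (\<not> b) # v"
  by (cases b) auto

text \<open>The wreath recursion: \<open>e\<close> tells whether the two subtrees of the root are
  exchanged, \<open>s\<close> and \<open>s'\<close> are the sections at 0 and 1. Sections multiply
  under composition, crosswise when the inner factor exchanges the subtrees.\<close>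

lemma Grig_decompose:
  assumes "g \<in> Grig"
  shows "\<exists>e. \<exists>s\<in>Grig. \<exists>s'\<in>Grig. \<forall>v. g (False # v) = e # s v \<and> g (True # v) = (\<not> e) # s' v"
  using assms
proof (induction rule: Grig_induct)
  case id
  then show ?case by (intro exI[of _ False] bexI[of _ id]) auto
next
  case (gen x)
  have g: "gen_a \<in> Grig" "gen_b \<in> Grig" "gen_c \<in> Grig" "gen_d \<in> Grig"
    using gens_Grig by auto
  from gen consider "x = gen_a" | "x = gen_b" | "x = gen_c" | "x = gen_d" by blast
  then show ?case
  proof cases
    case 1
    then show ?thesis by (intro exI[of _ True] bexI[of _ id]) auto
  next
    case 2
    then show ?thesis using g by (intro exI[of _ False] bexI[of _ gen_a] bexI[of _ gen_c]) auto
  next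
    case 3
    then show ?thesis using g by (intro exI[of _ False] bexI[of _ gen_a] bexI[of _ gen_d]) auto
  next
    case 4
    then show ?thesis using g by (intro exI[of _ False] bexI[of _ id] bexI[of _ gen_b]) auto
  qed
next
  case (comp g h)
  obtain e s s' where g: "s \<in> Grig" "s' \<in> Grig"
    "\<And>v. g (False # v) = e # s v" "\<And>v. g (True # v) = (\<not> e) # s' v"
    using comp(3) by blast
  obtain f r r' where h: "r \<in> Grig" "r' \<in> Grig"
    "\<And>v. h (False # v) = f # r v" "\<And>v. h (True # v) = (\<not> f) # r' v"
    using comp(4) by blast
  show ?case
  proof (cases f)
    case True
    then show ?thesis using g h
      by (intro exI[of _ "\<not> e"] bexI[of _ "s' \<circ> r"] bexI[of _ "s \<circ> r'"]) auto
  next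
    case False
    then show ?thesis using g h
      by (intro exI[of _ e] bexI[of _ "s \<circ> r"] bexI[of _ "s' \<circ> r'"]) auto
  qed
qed

lemma Grig_section:
  assumes "g \<in> Grig"
  obtains s where "s \<in> Grig" "\<And>v. g (u @ v) = g u @ s v"
proof -
  have "\<exists>s\<in>Grig. \<forall>v. g (u @ v) = g u @ s v"
    using assms
  proof (induction u arbitrary: g)
    case Nil
    then show ?case by (intro bexI[of _ g]) (simp_all add: Grig_Nil)
  next
    case (Cons b u)
    obtain e s s' where s: "s \<in> Grig" "s' \<in> Grig"
      "\<And>v. g (False # v) = e # s v" "\<And>v. g (True # v) = (\<not> e) # s' v"
      using Grig_decompose[OF Cons.prems] by blast
    show ?case
    proof (cases b)
      case True
      then show ?thesis using Cons.IH[OF s(2)] s(4) by simp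
    next
      case False
      then show ?thesis using Cons.IH[OF s(1)] s(3) by simp
    qed
  qed
  then show ?thesis using that by blast
qed

text \<open>The stabilizer of the vertex 1 projects onto the whole group: \<open>aba\<close>,
  \<open>d\<close>, \<open>b\<close>, \<open>c\<close> fix this vertex and have the sections
  \<open>a\<close>, \<open>b\<close>, \<open>c\<close>, \<open>d\<close> there. Composing with
  \<open>gen_a\<close> on either side gives the other choices of the two letters.\<close>

lemma Grig_lift_Cons:
  assumes "g \<in> Grig"
  shows "\<exists>h\<in>Grig. \<forall>v. h (b # v) = b' # g v"
proof -
  have G: "gen_a \<in> Grig" "gen_b \<in> Grig" "gen_c \<in> Grig" "gen_d \<in> Grig"
    using gens_Grig by simp_all
  have "\<exists>h\<in>Grig. \<forall>v. h (True # v) = True # g v"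
    using assms
  proof (induction rule: Grig_induct)
    case id
    show ?case by (intro bexI[of _ id]) simp_all
  next
    case (gen x)
    then consider "x = gen_a" | "x = gen_b" | "x = gen_c" | "x = gen_d" by blast
    then show ?case
    proof cases
      case 1
      then show ?thesis using G by (intro bexI[of _ "gen_a \<circ> gen_b \<circ> gen_a"]) simp_all
    next
      case 2
      then show ?thesis using G by (intro bexI[of _ gen_d]) simp_all
    next
      case 3
      then show ?thesis using G by (intro bexI[of _ gen_b]) simp_all
    next
      case 4
      then show ?thesis using G by (intro bexI[of _ gen_c]) simp_all
    qed
  next
    case (comp g h)
    then obtain g' h' where "g' \<in> Grig" "\<forall>v. g' (True # v) = True # g v"
      "h' \<in> Grig" "\<forall>v. h' (True # v) = True # h v" by blast
    then show ?case by (intro bexI[of _ "g' \<circ> h'"]) simp_all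
  qed
  then obtain h where h: "h \<in> Grig" "\<forall>v. h (True # v) = True # g v" by blast
  define x y where "x = (if b then id else gen_a)" and "y = (if b' then id else gen_a)"
  have "x \<in> Grig" "y \<in> Grig" "\<And>v. x (b # v) = True # v" "\<And>v. y (True # v) = b' # v"
    using G by (simp_all add: x_def y_def)
  then show ?thesis using h by (intro bexI[of _ "y \<circ> h \<circ> x"]) simp_all
qed

lemma Grig_lift:
  assumes "g \<in> Grig" "length u = length u'"
  obtains h where "h \<in> Grig" "\<And>v. h (u @ v) = u' @ g v"
proof -
  have "\<exists>h\<in>Grig. \<forall>v. h (u @ v) = u' @ g v"
    using assms(2)
  proof (induction rule: list_induct2)
    case Nil
    show ?case using assms(1) by (intro bexI[of _ g]) simp_all
  next
    case (Cons b u b' u')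
    then obtain h where h: "h \<in> Grig" "\<forall>v. h (u @ v) = u' @ g v" by blast
    obtain k where "k \<in> Grig" "\<forall>v. k (b # v) = b' # h v"
      using Grig_lift_Cons[OF h(1)] by blast
    then show ?case using h(2) by (intro bexI[of _ k]) simp_all
  qed
  then show ?thesis using that by blast
qed

section \<open>The branching subgroup\<close>

definition below :: "bool list \<Rightarrow> (bool list \<Rightarrow> bool list) \<Rightarrow> bool list \<Rightarrow> bool list" where
  "below u x v = (if take (length u) v = u then u @ x (drop (length u) v) else v)"

lemma below_append [simp]: "below u x (u @ v) = u @ x v"
  by (simp add: below_def)

lemma below_other: "length w = length u \<Longrightarrow> w \<noteq> u \<Longrightarrow> below u x (w @ v) = w @ v"
  by (simp add: below_def)

lemma below_fix: "(\<And>w. v \<noteq> u @ w) \<Longrightarrow> below u x v = v"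
  unfolding below_def by (metis append_take_drop_id)

lemma below_Nil [simp]: "below [] x = x"
  by (simp add: below_def fun_eq_iff)

lemma below_Cons: "below (b # u) x (b' # v) = (if b' = b then b # below u x v else b' # v)"
  by (simp add: below_def)

lemma below_comp: "below u (x \<circ> y) = below u x \<circ> below u y"
  by (auto simp: below_def fun_eq_iff)

lemma below_id: "below u id = id"
  by (auto simp: below_def fun_eq_iff) (metis append_take_drop_id)

lemma below_below: "below u (below u' x) = below (u @ u') x"
proof
  fix v
  consider w where "v = (u @ u') @ w" | w where "v = u @ w" "\<And>w'. w \<noteq> u' @ w'" | "\<And>w. v \<noteq> u @ w"
    by (metis append.assoc)
  then show "below u (below u' x) v = below (u @ u') x v"
  proof cases
    case 1
    then show ?thesis by (metis append.assoc below_append)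
  next
    case 2
    then have "v \<noteq> (u @ u') @ w'" for w' by simp
    then show ?thesis using 2 by (simp add: below_fix)
  next
    case 3
    then have "v \<noteq> (u @ u') @ w'" for w' by simp
    then show ?thesis using 3 by (simp add: below_fix)
  qed
qed

lemma finv_below:
  assumes "bij x"
  shows "finv (below u x) = below u (finv x)"
proof (rule inv_unique_comp)
  show "below u x \<circ> below u (finv x) = id"
    using assms by (simp add: below_comp[symmetric] bij_is_surj surj_iff[THEN iffD1] below_id)
  show "below u (finv x) \<circ> below u x = id"
    using assms by (simp add: below_comp[symmetric] bij_is_inj below_id)
qed

text \<open>\<open>g\<close> carries the subtree of \<open>u\<close> to that of \<open>u'\<close> by
  means of \<open>z\<close>, so conjugation by \<open>g\<close> transports the support and
  conjugates \<open>x\<close> by the section \<open>z\<close>.\<close>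

lemma below_conj:
  assumes "bij g" "bij z" and g: "\<And>v. g (u @ v) = u' @ z v"
  shows "g \<circ> below u x \<circ> finv g = below u' (z \<circ> x \<circ> finv z)"
proof
  fix y
  show "(g \<circ> below u x \<circ> finv g) y = below u' (z \<circ> x \<circ> finv z) y"
  proof (cases "\<exists>v. y = u' @ z v")
    case True
    then obtain v where y: "y = u' @ z v" ..
    then have "finv g y = u @ v" "finv z (z v) = v"
      using g assms(1,2) by (metis bij_inv_eq_iff, metis bij_inv_eq_iff)
    then show ?thesis using y g by simp
  next
    case False
    then have no: "y \<noteq> u' @ w" for w
      using assms(2) by (metis bij_pointE)
    have "finv g y \<noteq> u @ v" for v
      using no g assms(1) by (metis bij_inv_eq_iff)
    then have "below u x (finv g y) = finv g y"
      by (rule below_fix)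
    then show ?thesis
      using below_fix[of y u'] no assms(1) by (simp add: bij_is_surj surj_f_inv_f)
  qed
qed

section \<open>The element t and its normal closure K\<close>

definition elt_t :: "bool list \<Rightarrow> bool list" where
  "elt_t = gen_a \<circ> gen_b \<circ> gen_a \<circ> gen_b"

text \<open>\<open>K\<close> will be the normal closure of \<open>elt_t\<close>. With the two copies
  of \<open>elt_t\<close> as further generators, no conjugates are needed to generate it, and claims
  about \<open>K\<close> reduce to three words.\<close>

definition K_gens :: "(bool list \<Rightarrow> bool list) set" where
  "K_gens = {elt_t, below [False] elt_t, below [True] elt_t}"

definition K :: "(bool list \<Rightarrow> bool list) set" where
  "K = generate grigorchuk_group K_gens"

text \<open>Together with the identity, \<open>b\<close>, \<open>c\<close>, \<open>d\<close> form a
  Klein four-group. The six relations are proved simultaneously because passing to the section at 1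
  permutes them.\<close>

lemma klein_relations [simp]:
  "gen_b (gen_c v) = gen_d v" "gen_c (gen_b v) = gen_d v"
  "gen_c (gen_d v) = gen_b v" "gen_d (gen_c v) = gen_b v"
  "gen_d (gen_b v) = gen_c v" "gen_b (gen_d v) = gen_c v"
proof -
  have "gen_b (gen_c v) = gen_d v \<and> gen_c (gen_b v) = gen_d v \<and>
    gen_c (gen_d v) = gen_b v \<and> gen_d (gen_c v) = gen_b v \<and>
    gen_d (gen_b v) = gen_c v \<and> gen_b (gen_d v) = gen_c v"
  proof (induction v)
    case (Cons b v)
    then show ?case by (cases b) (simp_all add: gen_a_gen_a)
  qed simp
  then show "gen_b (gen_c v) = gen_d v" "gen_c (gen_b v) = gen_d v"
    "gen_c (gen_d v) = gen_b v" "gen_d (gen_c v) = gen_b v"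
    "gen_d (gen_b v) = gen_c v" "gen_b (gen_d v) = gen_c v" by simp_all
qed

lemmas gens_simps = gen_a_gen_a gen_bcd_involutions klein_relations

lemma gens_in_Grig [simp]: "gen_a \<in> Grig" "gen_b \<in> Grig" "gen_c \<in> Grig" "gen_d \<in> Grig"
  using gens_Grig by simp_all

lemma elt_t_Grig [simp]: "elt_t \<in> Grig"
  by (simp add: elt_t_def)

lemma finv_elt_t: "finv elt_t = gen_b \<circ> gen_a \<circ> gen_b \<circ> gen_a"
  by (rule inv_unique_comp) (simp_all add: fun_eq_iff elt_t_def gens_simps)

text \<open>In pairs of sections, \<open>aba = (c, a)\<close> and \<open>d = (1, b)\<close>. Hence
  \<open>abad = (c, ab)\<close>, and its square is \<open>(1, t)\<close>.\<close>

lemma below_True_elt_t: "below [True] elt_t = gen_a \<circ> gen_b \<circ> gen_a \<circ> gen_d \<circ> gen_a \<circ> gen_b \<circ> gen_a \<circ> gen_d"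
proof
  fix v
  show "below [True] elt_t v = (gen_a \<circ> gen_b \<circ> gen_a \<circ> gen_d \<circ> gen_a \<circ> gen_b \<circ> gen_a \<circ> gen_d) v"
  proof (cases v)
    case (Cons b w)
    then show ?thesis by (cases b) (simp_all add: below_Cons elt_t_def gens_simps)
  qed (simp add: below_def)
qed

text \<open>Here \<open>b = (a, c)\<close> and \<open>ada = (b, 1)\<close>, so the square of
  \<open>bada = (ab, c)\<close> is \<open>(t, 1)\<close>.\<close>

lemma below_False_elt_t: "below [False] elt_t = gen_b \<circ> gen_a \<circ> gen_d \<circ> gen_a \<circ> gen_b \<circ> gen_a \<circ> gen_d \<circ> gen_a"
proof
  fix v
  show "below [False] elt_t v = (gen_b \<circ> gen_a \<circ> gen_d \<circ> gen_a \<circ> gen_b \<circ> gen_a \<circ> gen_d \<circ> gen_a) v"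
  proof (cases v)
    case (Cons b w)
    then show ?thesis by (cases b) (simp_all add: below_Cons elt_t_def gens_simps)
  qed (simp add: below_def)
qed

lemma K_gens_Grig: "K_gens \<subseteq> Grig"
  by (simp add: K_gens_def below_True_elt_t below_False_elt_t)

lemma subgroup_K: "subgroup K grigorchuk_group"
  unfolding K_def by (rule grig.generate_is_subgroup[OF K_gens_Grig])

lemma below_generate:
  assumes "subgroup H grigorchuk_group" "S \<subseteq> Grig"
    and "\<And>x. x \<in> S \<Longrightarrow> below u x \<in> H" and "y \<in> generate grigorchuk_group S"
  shows "below u y \<in> H"
proof -
  have H: "id \<in> H" "\<And>x y. x \<in> H \<Longrightarrow> y \<in> H \<Longrightarrow> x \<circ> y \<in> H" "\<And>x. x \<in> H \<Longrightarrow> finv x \<in> H"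
    using assms(1) by (simp_all add: subgroup_Grig_iff)
  from assms(4) show ?thesis
  proof induction
    case one
    then show ?case using H(1) by (simp only: Grig_one below_id)
  next
    case (incl x)
    then show ?case by (rule assms(3))
  next
    case (inv x)
    then have "x \<in> Grig" using assms(2) by blast
    then show ?case
      using H(3)[OF assms(3)[OF inv]] by (simp only: Grig_inv finv_below[OF Grig_bij])
  next
    case (eng x y)
    then have "x \<in> Grig" "y \<in> Grig"
      using grig.generate_in_carrier[OF assms(2)] by blast+
    then show ?case
      using H(2)[OF eng.IH] by (simp only: Grig_mult below_comp)
  qed
qed

lemma finv_comp: "g \<in> Grig \<Longrightarrow> h \<in> Grig \<Longrightarrow> finv (g \<circ> h) = finv h \<circ> finv g"
  by (simp add: Grig_bij o_inv_distrib)

text \<open>A lift of \<open>z\<close> that maps \<open>u\<close> to \<open>u'\<close> turns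
  conjugation by \<open>z\<close> inside the subtree into conjugation by an element of the whole
  group.\<close>

lemma normal_below_conj:
  assumes H: "H \<lhd> grigorchuk_group" and u: "below u x \<in> H" "length u' = length u" and z: "z \<in> Grig"
  shows "below u' (z \<circ> x \<circ> finv z) \<in> H"
proof -
  obtain g where g: "g \<in> Grig" "\<And>v. g (u @ v) = u' @ z v"
    using Grig_lift[OF z] u(2) by metis
  have "g \<circ> below u x \<circ> finv g = below u' (z \<circ> x \<circ> finv z)"
    by (rule below_conj) (use g z in \<open>simp_all add: Grig_bij\<close>)
  moreover have "g \<circ> below u x \<circ> finv g \<in> H"
    using H g(1) u(1) by (simp add: normal_Grig_iff)
  ultimately show ?thesis by simp
qed

text \<open>All three generators of \<open>K\<close> are products of conjugates of \<open>t\<close>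
  and their inverses: \<open>below [True] elt_t\<close> is the commutator of \<open>t\<close> and
  \<open>d\<close>, and conjugation by \<open>a\<close> turns it into
  \<open>below [False] elt_t\<close>. Such conjugates below any vertex of the level of
  \<open>u\<close> lie in \<open>H\<close>.\<close>

lemma normal_below_K_gens:
  assumes H: "H \<lhd> grigorchuk_group" and u: "below u elt_t \<in> H" "length u' = length u"
    and "x \<in> K_gens"
  shows "below u' x \<in> H"
proof -
  have cl: "\<And>x y. x \<in> H \<Longrightarrow> y \<in> H \<Longrightarrow> x \<circ> y \<in> H" "\<And>x. x \<in> H \<Longrightarrow> finv x \<in> H"
    using H by (simp_all add: normal_Grig_iff subgroup_Grig_iff)
  define q where "q z = z \<circ> elt_t \<circ> finv z" for z :: "bool list \<Rightarrow> bool list"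
  have q: "below u' (q z) \<in> H" if "z \<in> Grig" for z
    unfolding q_def by (rule normal_below_conj[OF H u that])
  have q_Grig: "q z \<in> Grig" if "z \<in> Grig" for z
    using that by (simp add: q_def)
  have qq: "below u' (q y \<circ> finv (q z)) \<in> H" if "y \<in> Grig" "z \<in> Grig" for y z
    using cl(1)[OF q[OF that(1)] cl(2)[OF q[OF that(2)]]] that
    by (simp only: below_comp finv_below[OF Grig_bij[OF q_Grig]])
  have fi: "finv gen_a = gen_a" "finv gen_d = gen_d"
    by (simp_all add: gens_inv)
  have "finv (q z) = z \<circ> finv elt_t \<circ> finv z" if "z \<in> Grig" for z
    using that by (simp add: q_def finv_comp inv_inv_eq Grig_bij o_assoc)
  then have qi: "finv (q gen_d) = gen_d \<circ> finv elt_t \<circ> gen_d"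
    "finv (q (gen_a \<circ> gen_d)) = gen_a \<circ> gen_d \<circ> finv elt_t \<circ> gen_d \<circ> gen_a"
    by (simp_all add: finv_comp fi o_assoc)
  from \<open>x \<in> K_gens\<close> consider "x = elt_t" | "x = below [False] elt_t" | "x = below [True] elt_t"
    by (auto simp: K_gens_def)
  then show ?thesis
  proof cases
    case 1
    then show ?thesis using q[of id] by (simp add: q_def)
  next
    case 2
    have "x = q gen_a \<circ> finv (q (gen_a \<circ> gen_d))"
      unfolding 2 qi unfolding q_def fi below_False_elt_t finv_elt_t
      by (simp add: elt_t_def fun_eq_iff gens_simps)
    then show ?thesis using qq[of gen_a "gen_a \<circ> gen_d"] by simp
  next
    case 3
    have "x = q id \<circ> finv (q gen_d)"
      unfolding 3 qi unfolding q_def below_True_elt_t finv_elt_t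
      by (simp add: elt_t_def fun_eq_iff gens_simps)
    then show ?thesis using qq[of id gen_d] by simp
  qed
qed

text \<open>It suffices to conjugate the three generators of \<open>K\<close> by \<open>a\<close>,
  \<open>b\<close>, \<open>c\<close>, \<open>d\<close> and to express the results through these
  generators.\<close>

lemma normal_K: "K \<lhd> grigorchuk_group"
proof -
  have cl: "\<And>x y. x \<in> K \<Longrightarrow> y \<in> K \<Longrightarrow> x \<circ> y \<in> K" "\<And>x. x \<in> K \<Longrightarrow> finv x \<in> K"
    using subgroup_K by (simp_all add: subgroup_Grig_iff)
  define t v w where "t = elt_t" and "v = below [False] elt_t" and "w = below [True] elt_t"
  have tvw: "t \<in> K" "v \<in> K" "w \<in> K"
    by (auto simp: t_def v_def w_def K_def K_gens_def intro: generate.incl)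
  have t: "t = gen_a \<circ> gen_b \<circ> gen_a \<circ> gen_b"
    "finv t = gen_b \<circ> gen_a \<circ> gen_b \<circ> gen_a"
    by (simp_all add: t_def elt_t_def[symmetric] finv_elt_t)
  have w: "w = gen_a \<circ> gen_b \<circ> gen_a \<circ> gen_d \<circ> gen_a \<circ> gen_b \<circ> gen_a \<circ> gen_d"
    by (simp add: w_def below_True_elt_t)
  have wi: "finv w = gen_d \<circ> gen_a \<circ> gen_b \<circ> gen_a \<circ> gen_d \<circ> gen_a \<circ> gen_b \<circ> gen_a"
    by (rule inv_unique_comp) (simp_all add: fun_eq_iff w gens_simps)
  have v: "v = gen_b \<circ> gen_a \<circ> gen_d \<circ> gen_a \<circ> gen_b \<circ> gen_a \<circ> gen_d \<circ> gen_a"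
    by (simp add: v_def below_False_elt_t)
  have vi: "finv v = gen_a \<circ> gen_d \<circ> gen_a \<circ> gen_b \<circ> gen_a \<circ> gen_d \<circ> gen_a \<circ> gen_b"
    by (rule inv_unique_comp) (simp_all add: fun_eq_iff v gens_simps)
  \<comment> \<open>\<open>v\<close> acts only below 0, where \<open>d\<close> is trivial. This
    relation rests on the action on the tree; the one for \<open>c\<close> follows from it through
    \<open>c = bd\<close>.\<close>
  have dv: "gen_d \<circ> v \<circ> gen_d = v"
  proof
    fix y show "(gen_d \<circ> v \<circ> gen_d) y = v y"
    proof (cases y)
      case (Cons b y)
      then show ?thesis by (cases b) (simp_all add: v_def below_Cons gens_simps)
    qed (simp add: v_def below_def elt_t_def)
  qed
  have cv: "gen_c \<circ> v \<circ> gen_c = finv v"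
  proof -
    have "gen_c \<circ> v \<circ> gen_c = gen_b \<circ> (gen_d \<circ> v \<circ> gen_d) \<circ> gen_b"
      by (simp add: fun_eq_iff gens_simps)
    then show ?thesis
      unfolding dv vi by (simp add: v fun_eq_iff gens_simps)
  qed
  have gen: "s \<circ> x \<circ> finv s \<in> K" if "s \<in> gens" "x \<in> K_gens" for s x
  proof -
    \<comment> \<open>The following relations hold already by cancellation of words, using the
      involutions and the Klein relations.\<close>
    have at: "gen_a \<circ> t \<circ> gen_a = finv t" "gen_b \<circ> t \<circ> gen_b = finv t"
      "gen_d \<circ> t \<circ> gen_d = finv w \<circ> t" "gen_c \<circ> t \<circ> gen_c = finv t \<circ> w"
      unfolding t(2) wi by (simp_all add: t(1) w fun_eq_iff gens_simps)
    have av: "gen_a \<circ> v \<circ> gen_a = w" "gen_b \<circ> v \<circ> gen_b = finv v"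
      unfolding vi by (simp_all add: v w fun_eq_iff gens_simps)
    have aw: "gen_a \<circ> w \<circ> gen_a = v" "gen_b \<circ> w \<circ> gen_b = finv t \<circ> finv w \<circ> t"
      "gen_d \<circ> w \<circ> gen_d = finv w" "gen_c \<circ> w \<circ> gen_c = finv t \<circ> w \<circ> t"
      unfolding t(2) wi by (simp_all add: t(1) v w fun_eq_iff gens_simps)
    have x: "x = t \<or> x = v \<or> x = w" and s: "s = gen_a \<or> s = gen_b \<or> s = gen_c \<or> s = gen_d"
      using that by (simp_all add: K_gens_def t_def v_def w_def)
    have "s \<circ> x \<circ> s \<in> K"
      using x s
      by (elim disjE) (simp_all only: at av aw dv cv tvw cl)
    then show ?thesis
      by (simp only: gens_inv[OF that(1)])
  qed
  have conj_gen: "s \<circ> x \<circ> finv s \<in> K" if s: "s \<in> gens" and "x \<in> K" for s x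
  proof -
    have sG: "s \<in> Grig" using s gens_Grig by blast
    have "x \<in> generate grigorchuk_group K_gens" using \<open>x \<in> K\<close> by (simp only: K_def)
    then show ?thesis
    proof induction
      case one
      have "s \<circ> id \<circ> finv s = id"
        using sG by (simp add: fun_eq_iff Grig_bij bij_is_surj surj_f_inv_f)
      then show ?case
        using subgroup_K by (simp only: Grig_one subgroup_Grig_iff)
    next
      case (incl x)
      then show ?case by (rule gen[OF s])
    next
      case (inv x)
      then have x: "x \<in> Grig" using K_gens_Grig by blast
      have "s \<circ> finv x \<circ> finv s = finv (s \<circ> x \<circ> finv s)"
        using sG x by (simp add: finv_comp inv_inv_eq Grig_bij o_assoc)
      then show ?case
        using cl(2)[OF gen[OF s inv]] x by (simp only: Grig_inv)
    next
      case (eng x y)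
      then have x: "x \<in> Grig" "y \<in> Grig"
        using grig.generate_in_carrier[OF K_gens_Grig] by blast+
      have "s \<circ> (x \<circ> y) \<circ> finv s = (s \<circ> x \<circ> finv s) \<circ> (s \<circ> y \<circ> finv s)"
        using sG by (simp add: fun_eq_iff Grig_bij bij_is_inj)
      then show ?case
        using cl(1)[OF eng.IH] x by (simp only: Grig_mult)
    qed
  qed
  have "g \<circ> x \<circ> finv g \<in> K" if "g \<in> Grig" "x \<in> K" for g x
    using that
  proof (induction arbitrary: x rule: Grig_induct)
    case (gen s)
    then show ?case by (rule conj_gen)
  next
    case (comp g h)
    have "(g \<circ> h) \<circ> x \<circ> finv (g \<circ> h) = g \<circ> (h \<circ> x \<circ> finv h) \<circ> finv g"
      by (simp only: finv_comp[OF comp(1,2)] o_assoc)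
    then show ?case using comp(3)[OF comp(4)[OF comp(5)]] by (simp only:)
  qed simp
  then show ?thesis
    using subgroup_K by (simp add: normal_Grig_iff)
qed

text \<open>The regular branch property. \<open>K\<close> is normal and contains a copy of
  \<open>t\<close> below a vertex of level 1, hence its own generators below both of these vertices;
  induction descends to every vertex.\<close>

lemma below_K: "k \<in> K \<Longrightarrow> below u k \<in> K"
proof (induction u)
  case (Cons b u)
  have "below [False] elt_t \<in> K"
    by (auto simp: K_def K_gens_def intro: generate.incl)
  then have "below [b] x \<in> K" if "x \<in> K_gens" for x
    by (rule normal_below_K_gens[OF normal_K]) (use that in simp_all)
  then have "below [b] (below u k) \<in> K"
    using below_generate[OF subgroup_K K_gens_Grig] Cons K_def by blast
  then show ?case
    by (simp add: below_below)
qed simp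

lemma K_Grig: "k \<in> K \<Longrightarrow> k \<in> Grig"
  using subgroup.mem_carrier[OF subgroup_K] .

section \<open>Commutators inside a normal subgroup\<close>

lemma below_commute:
  assumes "length u = length u'" "u \<noteq> u'"
  shows "below u x (below u' y v) = below u' y (below u x v)"
proof -
  consider w where "v = u @ w" | w where "v = u' @ w" | "\<And>w. v \<noteq> u @ w" "\<And>w. v \<noteq> u' @ w"
    by blast
  then show ?thesis
    using assms by cases (simp_all add: below_other below_fix)
qed

lemma elt_t_K: "elt_t \<in> K"
  by (auto simp: K_def K_gens_def intro: generate.incl)

lemma below_elt_t_Grig [simp]: "below u elt_t \<in> Grig"
  using below_K[OF elt_t_K] K_Grig by blast

text \<open>The section of \<open>t\<close> at 0 is \<open>ca\<close>. As \<open>a\<close> inverts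
  \<open>t\<close>, conjugating the inverse of \<open>t\<close> by \<open>ca\<close> gives
  \<open>ctc\<close>, which is the inverse of \<open>t\<close> times
  \<open>below [True] elt_t\<close>. The factor \<open>t\<close> in front cancels, and
  \<open>below [True] elt_t\<close> remains below 0.\<close>

lemma commutator_elt_t:
  "below [False] elt_t \<circ> elt_t \<circ> below [False] (finv elt_t) \<circ> finv elt_t = below [False, True] elt_t"
proof
  fix v
  have *: "below [False, True] elt_t = below [False] (below [True] elt_t)"
    by (simp add: below_below)
  show "(below [False] elt_t \<circ> elt_t \<circ> below [False] (finv elt_t) \<circ> finv elt_t) v
      = below [False, True] elt_t v"
    unfolding * below_True_elt_t finv_elt_t
  proof (cases v)
    case (Cons b w)
    then show "(below [False] elt_t \<circ> elt_t \<circ> below [False] (gen_b \<circ> gen_a \<circ> gen_b \<circ> gen_a) \<circ>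
        (gen_b \<circ> gen_a \<circ> gen_b \<circ> gen_a)) v
      = below [False] (gen_a \<circ> gen_b \<circ> gen_a \<circ> gen_d \<circ> gen_a \<circ> gen_b \<circ> gen_a \<circ> gen_d) v"
      by (cases b) (simp_all add: below_Cons elt_t_def gens_simps)
  qed (simp add: below_def elt_t_def)
qed

text \<open>Two commutators are taken. \<open>g\<close> exchanges the subtrees of \<open>w0\<close>
  and \<open>w1\<close>, so its commutator \<open>c\<close> with a copy \<open>x\<close> of
  \<open>t\<close> below \<open>w00\<close> is a factor \<open>p\<close> below \<open>w1\<close>
  times the inverse of \<open>x\<close>. A second commutator, with the copy \<open>Y\<close> of
  \<open>t\<close> below \<open>w0\<close>, removes \<open>p\<close> and leaves the commutator of
  two copies of \<open>t\<close>.\<close>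

lemma normal_contains_below:
  assumes H: "H \<lhd> grigorchuk_group" and g: "g \<in> H" "g w = w" "g (w @ [b]) \<noteq> w @ [b]"
  shows "below (w @ [False, False, True]) elt_t \<in> H"
proof -
  have cl: "\<And>x y. x \<in> H \<Longrightarrow> y \<in> H \<Longrightarrow> x \<circ> y \<in> H" "\<And>x. x \<in> H \<Longrightarrow> finv x \<in> H"
    "\<And>x y. x \<in> Grig \<Longrightarrow> y \<in> H \<Longrightarrow> x \<circ> y \<circ> finv x \<in> H" "H \<subseteq> Grig"
    using H by (simp_all add: normal_Grig_iff subgroup_Grig_iff)
  have gG: "g \<in> Grig" using g cl(4) by blast
  obtain s where s: "s \<in> Grig" "\<And>v. g (w @ v) = w @ s v"
    using Grig_section[OF gG, of w] g(2) by metis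
  obtain e s0 s1 where e: "s0 \<in> Grig" "s1 \<in> Grig"
    "\<And>v. s (False # v) = e # s0 v" "\<And>v. s (True # v) = (\<not> e) # s1 v"
    using Grig_decompose[OF s(1)] by blast
  have e
  proof (rule ccontr)
    assume "\<not> e"
    then have "s [b] = [b]"
      using e by (cases b) (simp_all add: Grig_Nil)
    then show False
      using s(2) g(3) by simp
  qed
  then have g0: "g ((w @ [False]) @ v) = (w @ [True]) @ s0 v" for v
    using s(2) e(3) by simp
  define x where "x = below (w @ [False]) (below [False] elt_t)"
  define x' where "x' = below (w @ [False]) (below [False] (finv elt_t))"
  define Y where "Y = below (w @ [False]) elt_t"
  define q where "q = s0 \<circ> below [False] elt_t \<circ> finv s0"
  define p where "p = g \<circ> x \<circ> finv g"
  have p_eq: "p = below (w @ [True]) q"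
    unfolding p_def q_def x_def
    by (rule below_conj) (use gG e(1) g0 in \<open>simp_all add: Grig_bij\<close>)
  have xx: "finv x = x'" "finv x' = x"
    by (simp_all add: x_def x'_def finv_below Grig_bij inv_inv_eq bij_imp_bij_inv flip: below_comp
        add: below_below)
  have Gs: "x \<in> Grig" "Y \<in> Grig"
    by (simp_all add: x_def Y_def below_below)
  have x'G: "x' \<in> Grig"
    using Gs(1) xx(1) Grig_inv_closed by blast
  have pG: "p \<in> Grig"
    unfolding p_def using gG Gs by (intro Grig_comp Grig_inv_closed)
  define c where "c = p \<circ> x'"
  have "x \<circ> finv g \<circ> finv x \<in> H"
    by (intro cl g Gs)
  then have "g \<circ> (x \<circ> finv g \<circ> x') \<in> H"
    using cl(1)[OF g(1)] xx(1) by simp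
  then have cH: "c \<in> H"
    by (simp only: c_def p_def o_assoc)
  have "finv c = x \<circ> finv p"
    using finv_comp[OF pG x'G] by (simp only: c_def xx)
  moreover have "finv c \<circ> (Y \<circ> c \<circ> finv Y) \<in> H"
    by (intro cl cH Gs)
  ultimately have "x \<circ> finv p \<circ> (Y \<circ> (p \<circ> x') \<circ> finv Y) \<in> H"
    by (simp only: c_def)
  \<comment> \<open>\<open>Y\<close> acts below \<open>w0\<close> and \<open>p\<close> below
    \<open>w1\<close>; this is why \<open>p\<close> cancels.\<close>
  moreover have "Y (p v) = p (Y v)" for v
    unfolding Y_def p_eq by (rule below_commute) simp_all
  then have "x \<circ> finv p \<circ> (Y \<circ> (p \<circ> x') \<circ> finv Y) = x \<circ> Y \<circ> x' \<circ> finv Y"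
    using pG by (simp add: fun_eq_iff Grig_bij bij_is_inj)
  moreover have "x \<circ> Y \<circ> x' \<circ> finv Y = below (w @ [False]) (below [False, True] elt_t)"
    unfolding x_def Y_def x'_def finv_below[OF Grig_bij[OF elt_t_Grig]] below_comp[symmetric]
      commutator_elt_t ..
  ultimately show ?thesis
    by (simp add: below_below)
qed

lemma below_K_normal:
  assumes H: "H \<lhd> grigorchuk_group" and g: "g \<in> H" "g w = w" "g (w @ [b]) \<noteq> w @ [b]"
    and "length u = length w + 3" "x \<in> K_gens"
  shows "below u x \<in> H"
  by (rule normal_below_K_gens[OF H normal_contains_below[OF H g]]) (use assms in simp_all)

definition level_stabilizer :: "nat \<Rightarrow> (bool list \<Rightarrow> bool list) set" where
  "level_stabilizer n = {g. \<forall>v. length v = n \<longrightarrow> g v = v}"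

text \<open>\<open>n\<close> is one less than the first level moved by \<open>H\<close>. Some
  element then moves a vertex of level \<open>n + 1\<close> but fixes its parent, and the commutator
  argument yields copies three levels below this parent.\<close>

lemma normal_level:
  assumes H: "H \<lhd> grigorchuk_group" and "H \<noteq> {id}"
  obtains n where "H \<subseteq> level_stabilizer n"
    "\<And>u x. length u = n + 3 \<Longrightarrow> x \<in> K_gens \<Longrightarrow> below u x \<in> H"
proof -
  have HG: "H \<subseteq> Grig" "id \<in> H"
    using H by (simp_all add: normal_Grig_iff subgroup_Grig_iff)
  define P where "P n \<longleftrightarrow> \<not> H \<subseteq> level_stabilizer n" for n
  have "\<exists>n. P n"
  proof -
    obtain g where "g \<in> H" "g \<noteq> id" using assms HG(2) by blast
    then obtain v where "g v \<noteq> v" by (auto simp: fun_eq_iff)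
    then show ?thesis
      using \<open>g \<in> H\<close> unfolding P_def level_stabilizer_def by blast
  qed
  then have P: "P (LEAST n. P n)" "\<And>m. m < (LEAST n. P n) \<Longrightarrow> \<not> P m"
    by (auto intro: LeastI_ex dest: not_less_Least)
  have "\<not> P 0"
    using HG(1) Grig_Nil by (auto simp: P_def level_stabilizer_def)
  then obtain n where n: "(LEAST n. P n) = Suc n"
    using P(1) by (metis not0_implies_Suc)
  then have st: "H \<subseteq> level_stabilizer n" "\<not> H \<subseteq> level_stabilizer (Suc n)"
    using P by (auto simp: P_def)
  then obtain g v where gv: "g \<in> H" "length v = Suc n" "g v \<noteq> v"
    by (auto simp: level_stabilizer_def)
  then obtain w b where v: "v = w @ [b]" by (cases v rule: rev_cases) auto
  then have w: "g w = w" "length w = n" using gv st(1) by (auto simp: level_stabilizer_def)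
  show ?thesis
    by (rule that[OF st(1)]) (use below_K_normal[OF H gv(1) w(1)] gv(3) v w(2) in simp)
qed

section \<open>Indices and generators from above\<close>

text \<open>This expresses that \<open>H\<close> has at most \<open>q\<close> right cosets: elements
  get labels below \<open>q\<close>, and equal labels force equal cosets. Labels may vary within a
  coset, so they can be assembled from labels of sections and remain valid for larger
  \<open>H\<close>.\<close>

definition coset_bound :: "(bool list \<Rightarrow> bool list) set \<Rightarrow> nat \<Rightarrow> bool" where
  "coset_bound H q \<longleftrightarrow> (\<exists>F. (\<forall>g\<in>Grig. F g < q) \<and>
     (\<forall>g\<in>Grig. \<forall>h\<in>Grig. F g = F h \<longrightarrow> g \<circ> finv h \<in> H))"

lemma coset_bound_mono: "coset_bound H q \<Longrightarrow> H \<subseteq> H' \<Longrightarrow> coset_bound H' q"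
  unfolding coset_bound_def by blast

lemma coset_bound_rcosets:
  assumes H: "subgroup H grigorchuk_group" and "coset_bound H q"
  shows "finite_index grigorchuk_group H" "subgroup_index grigorchuk_group H \<le> q"
proof -
  obtain F where F: "\<And>g. g \<in> Grig \<Longrightarrow> F g < q"
    "\<And>g h. g \<in> Grig \<Longrightarrow> h \<in> Grig \<Longrightarrow> F g = F h \<Longrightarrow> g \<circ> finv h \<in> H"
    using assms(2) unfolding coset_bound_def by blast
  define r where "r C = (SOME g. g \<in> Grig \<and> C = H #>\<^bsub>grigorchuk_group\<^esub> g)" for C
  have r: "r C \<in> Grig" "C = H #>\<^bsub>grigorchuk_group\<^esub> r C" if "C \<in> rcosets\<^bsub>grigorchuk_group\<^esub> H" for C
  proof -
    have "\<exists>g. g \<in> Grig \<and> C = H #>\<^bsub>grigorchuk_group\<^esub> g"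
      using that by (auto simp: RCOSETS_def)
    from someI_ex[OF this] show "r C \<in> Grig" "C = H #>\<^bsub>grigorchuk_group\<^esub> r C"
      unfolding r_def by blast+
  qed
  have inj: "inj_on (F \<circ> r) (rcosets\<^bsub>grigorchuk_group\<^esub> H)"
  proof (rule inj_onI)
    fix C C' assume C: "C \<in> rcosets\<^bsub>grigorchuk_group\<^esub> H" "C' \<in> rcosets\<^bsub>grigorchuk_group\<^esub> H"
      and "(F \<circ> r) C = (F \<circ> r) C'"
    then have "r C \<circ> finv (r C') \<in> H"
      using F(2) r(1) by simp
    then have "r C \<otimes>\<^bsub>grigorchuk_group\<^esub> inv\<^bsub>grigorchuk_group\<^esub> (r C') \<in> H"
      using r(1)[OF C(1)] r(1)[OF C(2)] by (simp only: Grig_inv Grig_mult Grig_inv_closed)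
    then have "r C \<in> H #>\<^bsub>grigorchuk_group\<^esub> r C'"
      using subgroup.rcos_module[OF H group_grigorchuk_group r(1)[OF C(2)] r(1)[OF C(1)]] by blast
    then have "H #>\<^bsub>grigorchuk_group\<^esub> r C' = H #>\<^bsub>grigorchuk_group\<^esub> r C"
      using grig.repr_independence[OF _ r(1)[OF C(2)] H] by blast
    then show "C = C'"
      using r(2) C by metis
  qed
  have sub: "(F \<circ> r) ` (rcosets\<^bsub>grigorchuk_group\<^esub> H) \<subseteq> {..<q}"
    using F(1) r(1) by auto
  then show "finite_index grigorchuk_group H" "subgroup_index grigorchuk_group H \<le> q"
    unfolding finite_index_def subgroup_index_def
    using inj_on_finite[OF inj sub] card_inj_on_le[OF inj sub] by simp_all
qed

text \<open>Modulo \<open>K\<close>, the generator \<open>b\<close> commutes with \<open>a\<close>,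
  because \<open>(ab)^2\<close> lies in \<open>K\<close>. It also commutes with \<open>d\<close>,
  and \<open>a\<close>, \<open>d\<close> generate the dihedral group \<open>D\<close> with at most 8
  elements. As \<open>c = bd\<close>, the products \<open>x\<close> and \<open>xb\<close> with
  \<open>x\<close> in \<open>D\<close> meet all cosets.\<close>

lemma coset_bound_K: "coset_bound K 16"
proof -
  let ?a = gen_a and ?b = gen_b and ?d = gen_d
  define D where "D = set [id, ?a, ?d, ?a \<circ> ?d, ?d \<circ> ?a, ?a \<circ> ?d \<circ> ?a, ?d \<circ> ?a \<circ> ?d, ?a \<circ> ?d \<circ> ?a \<circ> ?d]"
  define T where "T = (\<lambda>(x, e). x \<circ> e) ` (D \<times> set [id, ?b])"
  define KT where "KT = {k \<circ> y | k y. k \<in> K \<and> y \<in> T}"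
  \<comment> \<open>\<open>d = (1, b)\<close> and \<open>ada = (b, 1)\<close> act on different
    subtrees and commute; hence the fourth power of \<open>ad\<close> is trivial.\<close>
  have dada: "?d \<circ> ?a \<circ> ?d \<circ> ?a = ?a \<circ> ?d \<circ> ?a \<circ> ?d"
  proof
    fix v show "(?d \<circ> ?a \<circ> ?d \<circ> ?a) v = (?a \<circ> ?d \<circ> ?a \<circ> ?d) v"
    proof (cases v)
      case (Cons b w)
      then show ?thesis by (cases b) simp_all
    qed simp
  qed
  have adada: "?a \<circ> ?d \<circ> ?a \<circ> ?d \<circ> ?a = ?d \<circ> ?a \<circ> ?d"
    unfolding dada[symmetric] by (simp add: fun_eq_iff gens_simps)
  have red: "?a \<circ> ?a = id" "?d \<circ> ?d = id" "y \<circ> ?a \<circ> ?a = y" "y \<circ> ?d \<circ> ?d = y"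
    for y :: "bool list \<Rightarrow> bool list"
    by (simp_all add: fun_eq_iff gens_simps)
  have D: "x \<circ> ?a \<in> D" "x \<circ> ?d \<in> D" if "x \<in> D" for x
  proof -
    have "x = id \<or> x = ?a \<or> x = ?d \<or> x = ?a \<circ> ?d \<or> x = ?d \<circ> ?a \<or>
        x = ?a \<circ> ?d \<circ> ?a \<or> x = ?d \<circ> ?a \<circ> ?d \<or> x = ?a \<circ> ?d \<circ> ?a \<circ> ?d"
      using that by (simp only: D_def list.set insert_iff empty_iff simp_thms)
    then have "x \<circ> ?a \<in> D \<and> x \<circ> ?d \<in> D"
      unfolding D_def list.set
      by (elim disjE) (simp_all only: id_comp red dada adada insert_iff simp_thms)
    then show "x \<circ> ?a \<in> D" "x \<circ> ?d \<in> D"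
      by simp_all
  qed
  have DG: "x \<in> Grig" if "x \<in> D" for x
    using that unfolding D_def list.set insert_iff empty_iff
    by (elim disjE FalseE) (simp_all only: Grig_id Grig_comp gens_in_Grig)
  have KK: "\<And>x y. x \<in> K \<Longrightarrow> y \<in> K \<Longrightarrow> x \<circ> y \<in> K" "id \<in> K" "\<And>x. x \<in> K \<Longrightarrow> finv x \<in> K"
    "\<And>g x. g \<in> Grig \<Longrightarrow> x \<in> K \<Longrightarrow> g \<circ> x \<circ> finv g \<in> K"
    using normal_K by (simp_all add: normal_Grig_iff subgroup_Grig_iff)
  have TI: "x \<in> T" "x \<circ> ?b \<in> T" if "x \<in> D" for x
    using that by (force simp: T_def)+
  have KTI: "k \<circ> y \<in> KT" if "k \<in> K" "y \<in> T" for k y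
    using that unfolding KT_def by blast
  have step: "z \<circ> ?a \<in> KT \<and> z \<circ> ?b \<in> KT \<and> z \<circ> ?d \<in> KT" if zKT: "z \<in> KT" for z
  proof -
    obtain k y where k: "k \<in> K" and "y \<in> T" and z: "z = k \<circ> y"
      using zKT unfolding KT_def by blast
    then obtain x where x: "x \<in> D" and "y = x \<circ> id \<or> y = x \<circ> ?b"
      unfolding T_def by auto
    then consider "z = k \<circ> x" | "z = k \<circ> (x \<circ> ?b)" 
      using z by (auto simp only: comp_id)
    then show ?thesis
    proof cases
      case 1
      then have "z \<circ> ?a = k \<circ> (x \<circ> ?a)" "z \<circ> ?b = k \<circ> (x \<circ> ?b)" "z \<circ> ?d = k \<circ> (x \<circ> ?d)"
        by (simp_all add: o_assoc)
      then show ?thesis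
        using KTI[OF k] TI D x by metis
    next
      case 2
      define k' where "k' = k \<circ> (x \<circ> finv elt_t \<circ> finv x)"
      have k': "k' \<in> K"
        unfolding k'_def by (intro KK k DG x elt_t_K)
      \<comment> \<open>\<open>ba\<close> is the inverse of \<open>t\<close> times
        \<open>ab\<close>; moving that inverse to the left past \<open>x\<close> conjugates it
        within \<open>K\<close>.\<close>
      have "x \<circ> ?b \<circ> ?a = (x \<circ> finv elt_t \<circ> finv x) \<circ> (x \<circ> ?a \<circ> ?b)"
        using DG[OF x] by (simp add: finv_elt_t fun_eq_iff gens_simps Grig_bij bij_is_inj)
      then have "z \<circ> ?a = k' \<circ> (x \<circ> ?a \<circ> ?b)"
        unfolding 2 k'_def by (metis o_assoc)
      moreover have "z \<circ> ?b = k \<circ> x" "z \<circ> ?d = k \<circ> (x \<circ> ?d \<circ> ?b)"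
        unfolding 2 by (simp_all add: fun_eq_iff gens_simps)
      ultimately show ?thesis
        using KTI[OF k] KTI[OF k'] TI D x by metis
    qed
  qed
  have KT: "z \<circ> g \<in> KT" if "g \<in> Grig" "z \<in> KT" for g z
    using that
  proof (induction arbitrary: z rule: Grig_induct)
    case (gen s)
    have "z \<circ> gen_c = z \<circ> ?b \<circ> ?d"
      by (simp add: fun_eq_iff)
    then have "z \<circ> gen_c \<in> KT"
      using step gen(2) by metis
    then show ?case
      using step gen by blast
  next
    case (comp g h)
    then show ?case by (simp only: o_assoc)
  qed simp
  have "id \<in> D" by (simp add: D_def)
  then have "id \<in> KT"
    using KTI[OF KK(2) TI(1)] by (simp only: id_comp)
  then have "g \<in> KT" if "g \<in> Grig" for g
    using KT[OF that \<open>id \<in> KT\<close>] by (simp only: id_comp)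
  then have "\<exists>y. \<forall>g\<in>Grig. y g \<in> T \<and> (\<exists>k\<in>K. g = k \<circ> y g)"
    unfolding KT_def by (intro bchoice) blast
  then obtain y where y: "\<And>g. g \<in> Grig \<Longrightarrow> y g \<in> T" "\<And>g. g \<in> Grig \<Longrightarrow> \<exists>k\<in>K. g = k \<circ> y g"
    by blast
  have TG: "z \<in> Grig" if "z \<in> T" for z
    using that DG by (auto simp: T_def)
  have "card D \<le> 8"
    unfolding D_def by (rule order_trans[OF card_length]) simp
  moreover have "card (set [id, ?b]) \<le> 2"
    by (rule order_trans[OF card_length]) simp
  ultimately have "card (D \<times> set [id, ?b]) \<le> 8 * 2"
    unfolding card_cartesian_product by (rule mult_le_mono)
  moreover have fin: "finite (D \<times> set [id, ?b])"
    unfolding D_def by blast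
  ultimately have "card T \<le> 16" "finite T"
    unfolding T_def using card_image_le[OF fin, of "\<lambda>(x, e). x \<circ> e"] by simp_all
  then obtain f where bij: "bij_betw f T {0..<card T}"
    using ex_bij_betw_finite_nat by blast
  then have f: "f z < 16" if "z \<in> T" for z
    using bij_betwE[OF bij] \<open>card T \<le> 16\<close> that by fastforce
  have f_inj: "inj_on f T"
    using bij by (rule bij_betw_imp_inj_on)
  have "g \<circ> finv h \<in> K" if g: "g \<in> Grig" "h \<in> Grig" and "f (y g) = f (y h)" for g h
  proof -
    have "y g = y h"
      using f_inj y(1)[OF g(1)] y(1)[OF g(2)] that(3) by (simp add: inj_on_eq_iff)
    moreover obtain k l where "k \<in> K" "l \<in> K" "g = k \<circ> y g" "h = l \<circ> y h"
      using y(2) g by blast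
    moreover have "y h \<in> Grig"
      using y(1) TG g by blast
    moreover have "k \<circ> z \<circ> finv (l \<circ> z) = k \<circ> finv l" if "z \<in> Grig" for z
      using finv_comp[OF K_Grig[OF \<open>l \<in> K\<close>] that] that
      by (simp add: fun_eq_iff Grig_bij bij_is_surj surj_f_inv_f)
    ultimately show ?thesis
      using KK by metis
  qed
  then show ?thesis
    unfolding coset_bound_def using f y(1) by (intro exI[of _ "f \<circ> y"]) simp
qed

section \<open>Products of the copies of K below a level\<close>

definition K_level_gens :: "nat \<Rightarrow> (bool list \<Rightarrow> bool list) set" where
  "K_level_gens n = (\<lambda>(u, x). below u x) ` ({u. length u = n} \<times> K_gens)"

definition K_level :: "nat \<Rightarrow> (bool list \<Rightarrow> bool list) set" where
  "K_level n = generate grigorchuk_group (K_level_gens n)"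

lemma K_level_gens_Grig: "K_level_gens n \<subseteq> Grig"
proof -
  have "x \<in> K" if "x \<in> K_gens" for x
    using that by (simp add: K_def generate.incl)
  then show ?thesis
    using below_K K_Grig by (auto simp: K_level_gens_def)
qed

lemma subgroup_K_level: "subgroup (K_level n) grigorchuk_group"
  unfolding K_level_def by (rule grig.generate_is_subgroup[OF K_level_gens_Grig])

lemma K_level_0: "K_level 0 = K"
proof -
  have "K_level_gens 0 = K_gens"
    by (force simp: K_level_gens_def image_iff)
  then show ?thesis
    by (simp only: K_level_def K_def)
qed

lemma below_K_level:
  assumes "x \<in> K_level n"
  shows "below [b] x \<in> K_level (Suc n)"
proof (rule below_generate[OF subgroup_K_level K_level_gens_Grig])
  show "x \<in> generate grigorchuk_group (K_level_gens n)"
    using assms by (simp only: K_level_def)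
  fix y assume "y \<in> K_level_gens n"
  then obtain u z where "length u = n" "z \<in> K_gens" "y = below u z"
    by (auto simp: K_level_gens_def)
  then have "below [b] y \<in> K_level_gens (Suc n)"
    by (force simp: K_level_gens_def below_below)
  then show "below [b] y \<in> K_level (Suc n)"
    by (simp add: K_level_def generate.incl)
qed

text \<open>The new label records whether the subtrees of the root are exchanged and the labels of
  both sections: \<open>2 * q * q\<close> values. If all three agree for \<open>g\<close> and
  \<open>h\<close>, the quotient fixes level 1 and its sections are quotients in
  \<open>K_level n\<close>.\<close>

lemma coset_bound_K_level_Suc:
  assumes "coset_bound (K_level n) q"
  shows "coset_bound (K_level (Suc n)) (2 * q\<^sup>2)"
proof -
  obtain F where F: "\<And>g. g \<in> Grig \<Longrightarrow> F g < q"
    "\<And>g h. g \<in> Grig \<Longrightarrow> h \<in> Grig \<Longrightarrow> F g = F h \<Longrightarrow> g \<circ> finv h \<in> K_level n"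
    using assms unfolding coset_bound_def by blast
  have "\<forall>g\<in>Grig. \<exists>t. fst (snd t) \<in> Grig \<and> snd (snd t) \<in> Grig \<and>
    (\<forall>v. g (False # v) = fst t # fst (snd t) v \<and> g (True # v) = (\<not> fst t) # snd (snd t) v)"
  proof
    fix g assume "g \<in> Grig"
    from Grig_decompose[OF this] obtain e s s' where "s \<in> Grig" "s' \<in> Grig"
      "\<forall>v. g (False # v) = e # s v \<and> g (True # v) = (\<not> e) # s' v"
      by blast
    then show "\<exists>t. fst (snd t) \<in> Grig \<and> snd (snd t) \<in> Grig \<and>
      (\<forall>v. g (False # v) = fst t # fst (snd t) v \<and> g (True # v) = (\<not> fst t) # snd (snd t) v)"
      by (intro exI[of _ "(e, s, s')"]) simp
  qed
  from bchoice[OF this] obtain \<tau> where \<tau>: "\<forall>g\<in>Grig. fst (snd (\<tau> g)) \<in> Grig \<and> snd (snd (\<tau> g)) \<in> Grig \<and>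
    (\<forall>v. g (False # v) = fst (\<tau> g) # fst (snd (\<tau> g)) v \<and>
      g (True # v) = (\<not> fst (\<tau> g)) # snd (snd (\<tau> g)) v)"
    by blast
  define e s r where "e g = fst (\<tau> g)" and "s g = fst (snd (\<tau> g))" and "r g = snd (snd (\<tau> g))" for g
  have D: "s g \<in> Grig" "r g \<in> Grig" "g (False # v) = e g # s g v" "g (True # v) = (\<not> e g) # r g v"
    if "g \<in> Grig" for g v
    using bspec[OF \<tau> that] unfolding e_def s_def r_def by blast+
  \<comment> \<open>Two digits to base \<open>q\<close>, followed by a bit for the exchange; parity,
    division and remainder recover them.\<close>
  define F' where "F' g = (F (s g) * q + F (r g)) * 2 + (if e g then 1 else 0)" for g
  have "F' g < 2 * q\<^sup>2" if "g \<in> Grig" for g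
  proof -
    have "F (s g) < q" "F (r g) < q" using F(1) D that by blast+
    then have "Suc (F (s g)) * q \<le> q * q" "F (r g) < q"
      by (simp_all del: mult_Suc)
    then show ?thesis
      unfolding F'_def power2_eq_square by (simp split: if_splits)
  qed
  moreover have "g \<circ> finv h \<in> K_level (Suc n)" if g: "g \<in> Grig" and h: "h \<in> Grig" and eq: "F' g = F' h" for g h
  proof -
    have lt: "F (s g) < q" "F (r g) < q" "F (s h) < q" "F (r h) < q"
      using F(1) D g h by blast+
    have "even (F' g) = (\<not> e g)" "even (F' h) = (\<not> e h)"
      by (simp_all add: F'_def)
    then have e: "e g = e h" using eq by simp
    then have *: "F (s g) * q + F (r g) = F (s h) * q + F (r h)"
      using eq by (simp add: F'_def split: if_splits)
    have "F (s g) = F (s h)"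
      using arg_cong[OF *, of "\<lambda>x. x div q"] lt by simp
    moreover have "F (r g) = F (r h)"
      using arg_cong[OF *, of "\<lambda>x. x mod q"] lt by simp
    ultimately have "below [e g] (s g \<circ> finv (s h)) \<in> K_level (Suc n)"
      "below [\<not> e g] (r g \<circ> finv (r h)) \<in> K_level (Suc n)"
      using F(2) D(1,2) g h by (simp_all add: below_K_level)
    moreover have "g \<circ> finv h = below [e g] (s g \<circ> finv (s h)) \<circ> below [\<not> e g] (r g \<circ> finv (r h))"
    proof
      fix y
      define z where "z = finv h y"
      have y: "y = h z"
        using h by (simp add: z_def Grig_bij bij_is_surj surj_f_inv_f)
      have i: "finv (s h) (s h v) = v" "finv (r h) (r h v) = v" for v
        using D(1,2)[OF h] by (simp_all add: Grig_bij bij_is_inj)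
      have "g z = below [e g] (s g \<circ> finv (s h)) (below [\<not> e g] (r g \<circ> finv (r h)) (h z))"
      proof (cases z)
        case Nil
        then show ?thesis using g h by (simp add: Grig_Nil below_def)
      next
        case (Cons b v)
        then show ?thesis
          using D(3,4)[OF g] D(3,4)[OF h] e i by (cases b) (simp_all add: below_Cons)
      qed
      then show "(g \<circ> finv h) y = (below [e g] (s g \<circ> finv (s h)) \<circ> below [\<not> e g] (r g \<circ> finv (r h))) y"
        by (simp only: comp_apply flip: y z_def)
    qed
    ultimately show ?thesis
      using subgroup_K_level[of "Suc n"] by (simp only: subgroup_Grig_iff)
  qed
  ultimately show ?thesis
    unfolding coset_bound_def by blast
qed

text \<open>Bounding \<open>2 * q\<close> instead of \<open>q\<close> makes the recursion a plain
  squaring, since twice the new bound is the square of \<open>2 * q\<close>. It starts at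
  \<open>2 * 16 = 2 ^ 5\<close>.\<close>

lemma coset_bound_K_level: "\<exists>q. coset_bound (K_level n) q \<and> 2 * q \<le> 2 ^ (5 * 2 ^ n)"
proof (induction n)
  case 0
  show ?case
    using coset_bound_K by (intro exI[of _ 16]) (simp add: K_level_0)
next
  case (Suc n)
  then obtain q where q: "coset_bound (K_level n) q" "2 * q \<le> 2 ^ (5 * 2 ^ n)" by blast
  have "2 * (2 * q\<^sup>2) = (2 * q)\<^sup>2"
    by (simp add: power2_eq_square)
  also have "\<dots> \<le> (2 ^ (5 * 2 ^ n))\<^sup>2"
    using q(2) by (rule power_mono) simp
  also have "\<dots> = 2 ^ (5 * 2 ^ Suc n)"
    by (simp add: power_mult[symmetric] mult.commute mult.assoc)
  finally show ?case
    using coset_bound_K_level_Suc[OF q(1)] by blast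
qed

section \<open>Generators over a subgroup of finite index\<close>

text \<open>For \<open>x\<close> in \<open>M\<close> outside \<open>L\<close>, every coset
  \<open>Mr\<close> contains the two different cosets \<open>Lr\<close> and \<open>Lxr\<close> of
  \<open>L\<close>.\<close>

lemma (in group) card_rcosets_proper_subgroup:
  assumes L: "subgroup L G" and M: "subgroup M G" and "L \<subset> M" and fin: "finite (rcosets L)"
  shows "finite (rcosets M)" "2 * card (rcosets M) \<le> card (rcosets L)"
proof -
  obtain x where x: "x \<in> M" "x \<notin> L" using assms(3) by blast
  have xG: "x \<in> carrier G" using x(1) subgroup.mem_carrier[OF M] by blast
  define r where "r D = (SOME g. g \<in> carrier G \<and> D = M #> g)" for D
  have r: "r D \<in> carrier G" "D = M #> r D" if "D \<in> rcosets M" for D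
  proof -
    have "\<exists>g. g \<in> carrier G \<and> D = M #> g"
      using that by (auto simp: RCOSETS_def)
    from someI_ex[OF this] show "r D \<in> carrier G" "D = M #> r D"
      unfolding r_def by blast+
  qed
  define \<phi> where "\<phi> p = L #> (if snd p then x \<otimes> r (fst p) else r (fst p))" for p
  have coset_M: "M #> g = M #> h" if "L #> g = L #> h" "g \<in> carrier G" "h \<in> carrier G" for g h
  proof -
    have "g \<in> L #> h"
      using rcos_self[OF that(2) L] that(1) by simp
    then have "g \<in> M #> h"
      using assms(3) by (auto simp: r_coset_def)
    then show ?thesis
      using repr_independence[OF _ that(3) M] by simp
  qed
  have xr: "M #> (if b then x \<otimes> r D else r D) = D" "(if b then x \<otimes> r D else r D) \<in> carrier G"
    if "D \<in> rcosets M" for D b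
  proof -
    have "x \<otimes> r D \<in> M #> r D"
      using x(1) by (auto simp: r_coset_def)
    then have "M #> r D = M #> (x \<otimes> r D)"
      using repr_independence[OF _ r(1)[OF that] M] by blast
    then show "M #> (if b then x \<otimes> r D else r D) = D" "(if b then x \<otimes> r D else r D) \<in> carrier G"
      using r[OF that] xG by auto
  qed
  have inj: "inj_on \<phi> ((rcosets M) \<times> UNIV)"
  proof (rule inj_onI)
    fix p p' assume p: "p \<in> (rcosets M) \<times> (UNIV :: bool set)" "p' \<in> (rcosets M) \<times> (UNIV :: bool set)"
      and eq: "\<phi> p = \<phi> p'"
    obtain D b D' b' where pp: "p = (D, b)" "p' = (D', b')" by fastforce
    then have D: "D \<in> rcosets M" "D' \<in> rcosets M" using p by auto
    have "L #> (if b then x \<otimes> r D else r D) = L #> (if b' then x \<otimes> r D' else r D')"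
      using eq by (simp only: pp \<phi>_def fst_conv snd_conv)
    from coset_M[OF this xr(2)[OF D(1)] xr(2)[OF D(2)]] have "D = D'"
      by (simp only: xr(1)[OF D(1)] xr(1)[OF D(2)])
    moreover have "L #> (x \<otimes> r D) \<noteq> L #> r D"
    proof
      assume "L #> (x \<otimes> r D) = L #> r D"
      then have "x \<otimes> r D \<in> L #> r D"
        using rcos_self[OF _ L, of "x \<otimes> r D"] xG r(1)[OF D(1)] by simp
      then have "x \<otimes> r D \<otimes> inv (r D) \<in> L"
        using subgroup.rcos_module[OF L is_group r(1)[OF D(1)]] xG r(1)[OF D(1)] by simp
      then show False
        using x(2) xG r(1)[OF D(1)] by (simp add: m_assoc)
    qed
    ultimately have "b = b'"
      using eq by (cases b; cases b') (auto simp: pp \<phi>_def)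
    with \<open>D = D'\<close> show "p = p'" by (simp add: pp)
  qed
  have "\<phi> p \<in> rcosets L" if "p \<in> (rcosets M) \<times> UNIV" for p
    using rcosetsI[OF subgroup.subset[OF L] xr(2)[of "fst p" "snd p"]] that
    by (simp only: \<phi>_def mem_Times_iff)
  then have sub: "\<phi> ` ((rcosets M) \<times> UNIV) \<subseteq> rcosets L"
    by blast
  have "finite ((rcosets M) \<times> (UNIV :: bool set))"
    using inj_on_finite[OF inj sub fin] .
  then show "finite (rcosets M)"
    by (rule finite_cartesian_productD1) simp
  show "2 * card (rcosets M) \<le> card (rcosets L)"
    using card_inj_on_le[OF inj sub fin] by (simp add: card_cartesian_product)
qed

text \<open>Adjoining an element of \<open>H\<close> outside the current subgroup at least halves
  the index in \<open>G\<close>, which can happen at most \<open>e\<close> times.\<close>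

lemma (in group) generate_over_subgroup:
  assumes H: "subgroup H G" and "subgroup L G" "L \<subseteq> H" "finite (rcosets L)" "card (rcosets L) \<le> 2 ^ e"
  shows "\<exists>S\<subseteq>H. finite S \<and> card S \<le> e \<and> generate G (L \<union> S) = H"
  using assms(2-)
proof (induction e arbitrary: L)
  case (0 L)
  have "L = H"
  proof (rule ccontr)
    assume "L \<noteq> H"
    then have "L \<subset> H" using 0(2) by blast
    from card_rcosets_proper_subgroup[OF 0(1) H this 0(3)]
    have "2 * card (rcosets H) \<le> 1" and fin: "finite (rcosets H)"
      using 0(4) by simp_all
    then have "card (rcosets H) = 0"
      by linarith
    moreover have "rcosets H \<noteq> {}"
      using rcosetsI[OF subgroup.subset[OF H] one_closed] by blast
    ultimately show False using fin by simp
  qed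
  then have "generate G (L \<union> {}) = H"
    using generate_subgroup_incl[OF subset_refl H] by (auto intro: generate.incl)
  then show ?case by (intro exI[of _ "{}"]) simp
next
  case (Suc e L)
  show ?case
  proof (cases "L = H")
    case True
    then have "generate G (L \<union> {}) = H"
      using generate_subgroup_incl[OF subset_refl H] by (auto intro: generate.incl)
    then show ?thesis by (intro exI[of _ "{}"]) simp
  next
    case False
    then obtain x where x: "x \<in> H" "x \<notin> L" using Suc.prems(2) by blast
    define M where "M = generate G (insert x L)"
    have xL: "insert x L \<subseteq> H" using x(1) Suc.prems(2) by blast
    then have "insert x L \<subseteq> carrier G" using subgroup.subset[OF H] by blast
    then have M: "subgroup M G" unfolding M_def by (rule generate_is_subgroup)
    have LM: "insert x L \<subseteq> M" unfolding M_def by (blast intro: generate.incl)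
    have MH: "M \<subseteq> H" unfolding M_def by (rule generate_subgroup_incl[OF xL H])
    have "L \<subset> M" using LM x(2) by blast
    from card_rcosets_proper_subgroup[OF Suc.prems(1) M this Suc.prems(3)]
    have "finite (rcosets M)" "card (rcosets M) \<le> 2 ^ e"
      using Suc.prems(4) by auto
    from Suc.IH[OF M MH this] obtain S where S: "S \<subseteq> H" "finite S" "card S \<le> e" "generate G (M \<union> S) = H"
      by blast
    have incl: "L \<union> insert x S \<subseteq> H" using xL S(1) by blast
    have sub: "subgroup (generate G (L \<union> insert x S)) G"
      using incl subgroup.subset[OF H] by (intro generate_is_subgroup) blast
    have "M \<subseteq> generate G (L \<union> insert x S)"
      unfolding M_def by (rule mono_generate) blast
    moreover have "S \<subseteq> generate G (L \<union> insert x S)"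
      by (blast intro: generate.incl)
    ultimately have "H \<subseteq> generate G (L \<union> insert x S)"
      using generate_subgroup_incl[OF _ sub, of "M \<union> S"] S(4) by blast
    moreover have "generate G (L \<union> insert x S) \<subseteq> H"
      by (rule generate_subgroup_incl[OF incl H])
    moreover have "card (insert x S) \<le> Suc e"
      using S(2,3) card_insert_le_m1[of "Suc e" S x] by (simp add: card_insert_if)
    ultimately show ?thesis
      using S(1,2) x(1) by (intro exI[of _ "insert x S"]) auto
  qed
qed

lemma card_bool_words: "finite {u :: bool list. length u = n}" "card {u :: bool list. length u = n} = 2 ^ n"
  using finite_lists_length_eq[of "UNIV :: bool set" n] card_lists_length_eq[of "UNIV :: bool set" n]
  by simp_all

text \<open>At most \<open>3 * 2 ^ n\<close> generators for \<open>K_level n\<close> and at most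
  \<open>5 * 2 ^ n\<close> further ones for \<open>H\<close>, together
  \<open>8 * 2 ^ n\<close>.\<close>

lemma generators_over_K_level:
  assumes H: "subgroup H grigorchuk_group" and K: "K_level_gens n \<subseteq> H"
  obtains S where "finite S" "S \<subseteq> H" "generate grigorchuk_group S = H" "card S \<le> 2 ^ (n + 3)"
proof -
  have KH: "K_level n \<subseteq> H"
    unfolding K_level_def by (rule grig.generate_subgroup_incl[OF K H])
  obtain q where q: "coset_bound (K_level n) q" "2 * q \<le> 2 ^ (5 * 2 ^ n)"
    using coset_bound_K_level by blast
  have "finite (rcosets\<^bsub>grigorchuk_group\<^esub> (K_level n))"
    "card (rcosets\<^bsub>grigorchuk_group\<^esub> (K_level n)) \<le> 2 ^ (5 * 2 ^ n)"
    using coset_bound_rcosets[OF subgroup_K_level q(1)] q(2)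
    by (simp_all add: finite_index_def subgroup_index_def)
  from grig.generate_over_subgroup[OF H subgroup_K_level KH this]
  obtain S where S: "S \<subseteq> H" "finite S" "card S \<le> 5 * 2 ^ n" "generate grigorchuk_group (K_level n \<union> S) = H"
    by blast
  define T where "T = K_level_gens n \<union> S"
  have TH: "T \<subseteq> H" using K S(1) by (simp add: T_def)
  have subT: "subgroup (generate grigorchuk_group T) grigorchuk_group"
    using TH subgroup.subset[OF H] by (intro grig.generate_is_subgroup) blast
  have "K_level n \<subseteq> generate grigorchuk_group T"
    unfolding K_level_def T_def by (rule grig.mono_generate) blast
  moreover have "S \<subseteq> generate grigorchuk_group T"
    unfolding T_def by (blast intro: generate.incl)
  ultimately have "H \<subseteq> generate grigorchuk_group T"
    using grig.generate_subgroup_incl[OF _ subT, of "K_level n \<union> S"] S(4) by blast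
  moreover have "generate grigorchuk_group T \<subseteq> H"
    by (rule grig.generate_subgroup_incl[OF TH H])
  moreover have fin: "finite ({u :: bool list. length u = n} \<times> K_gens)"
    using card_bool_words(1) by (simp add: K_gens_def)
  then have "finite (K_level_gens n)"
    unfolding K_level_gens_def by (rule finite_imageI)
  moreover have "card K_gens \<le> 3"
    unfolding K_gens_def by (simp add: card_insert_if)
  then have "card ({u :: bool list. length u = n} \<times> K_gens) \<le> 2 ^ n * 3"
    by (simp add: card_cartesian_product card_bool_words(2))
  then have "card (K_level_gens n) \<le> 2 ^ n * 3"
    unfolding K_level_gens_def by (rule order_trans[OF card_image_le[OF fin]])
  moreover have "card T \<le> card (K_level_gens n) + card S"
    unfolding T_def by (rule card_Un_le)
  ultimately show ?thesis
    using that[of T] TH S(2,3) by (simp add: T_def power_add)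
qed

section \<open>The index from below\<close>

text \<open>\<open>t\<close> maps 00 to 01, so the product of the copies of \<open>t\<close> below
  the vertices in \<open>A\<close> changes the last letter of \<open>u00\<close> exactly for
  \<open>u\<close> in \<open>A\<close>. This yields \<open>2 ^ 2 ^ j\<close> elements that are told
  apart on level \<open>j + 2\<close>.\<close>

lemma independent_flips:
  assumes H: "id \<in> H" "\<And>x y. x \<in> H \<Longrightarrow> y \<in> H \<Longrightarrow> x \<circ> y \<in> H"
    and below: "\<And>u. length u = j \<Longrightarrow> below u elt_t \<in> H" and A: "A \<subseteq> {u. length u = j}"
  shows "\<exists>g\<in>H. \<forall>u. length u = j \<longrightarrow> g (u @ [False, False]) = u @ [False, u \<in> A]"
proof -
  have "finite A" using A card_bool_words(1) finite_subset by blast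
  then show ?thesis
    using A
  proof (induction A)
    case empty
    show ?case using H(1) by (intro bexI[of _ id]) simp_all
  next
    case (insert w A)
    then obtain g where g: "g \<in> H" "\<And>u. length u = j \<Longrightarrow> g (u @ [False, False]) = u @ [False, u \<in> A]"
      by auto
    have w: "length w = j" "below w elt_t \<in> H" using insert.prems below by auto
    have t: "elt_t [False, False] = [False, True]" by (simp add: elt_t_def)
    have "(below w elt_t \<circ> g) (u @ [False, False]) = u @ [False, u \<in> insert w A]" if u: "length u = j" for u
      using g(2)[OF u] insert.hyps(2) t w(1) u by (cases "u = w") (simp_all add: below_other)
    then show ?case using H(2)[OF w(2) g(1)] by blast
  qed
qed

text \<open>Elements of one coset of \<open>H\<close> agree on level \<open>j + 2\<close>, so the
  flips for different sets of vertices lie in different cosets.\<close>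

lemma index_lower_bound:
  assumes H: "subgroup H grigorchuk_group" "H \<subseteq> level_stabilizer (j + 2)" "finite_index grigorchuk_group H"
  shows "2 ^ 2 ^ j \<le> subgroup_index grigorchuk_group H"
proof -
  let ?L = "{u :: bool list. length u = j}"
  have "\<forall>A\<in>Pow ?L. \<exists>g. g \<in> Grig \<and> (\<forall>u. length u = j \<longrightarrow> g (u @ [False, False]) = u @ [False, u \<in> A])"
  proof
    fix A assume "A \<in> Pow ?L"
    then have "A \<subseteq> ?L" by (rule PowD)
    from independent_flips[OF Grig_id Grig_comp below_elt_t_Grig this]
    show "\<exists>g. g \<in> Grig \<and> (\<forall>u. length u = j \<longrightarrow> g (u @ [False, False]) = u @ [False, u \<in> A])"
      by (simp only: Bex_def)
  qed
  from bchoice[OF this] obtain h where hh: "\<forall>A\<in>Pow ?L. h A \<in> Grig \<and>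
    (\<forall>u. length u = j \<longrightarrow> h A (u @ [False, False]) = u @ [False, u \<in> A])" ..
  have h: "h A \<in> Grig" "length u = j \<Longrightarrow> h A (u @ [False, False]) = u @ [False, u \<in> A]"
    if "A \<in> Pow ?L" for A u
    using bspec[OF hh that] by blast+
  have inj: "inj_on (\<lambda>A. H #>\<^bsub>grigorchuk_group\<^esub> h A) (Pow ?L)"
  proof (rule inj_onI)
    fix A B assume AB: "A \<in> Pow ?L" "B \<in> Pow ?L"
      and eq: "H #>\<^bsub>grigorchuk_group\<^esub> h A = H #>\<^bsub>grigorchuk_group\<^esub> h B"
    have "h A \<in> H #>\<^bsub>grigorchuk_group\<^esub> h B"
      using grig.rcos_self[OF h(1)[OF AB(1)] H(1)] eq by simp
    then obtain x where x: "x \<in> H" "h A = x \<otimes>\<^bsub>grigorchuk_group\<^esub> h B"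
      by (auto simp: r_coset_def)
    then have hx: "h A = x \<circ> h B"
      using subgroup.mem_carrier[OF H(1) x(1)] h(1)[OF AB(2)] by simp
    have "u \<in> A \<longleftrightarrow> u \<in> B" if u: "length u = j" for u
    proof -
      have "u @ [False, u \<in> A] = x (u @ [False, u \<in> B])"
        using fun_cong[OF hx, of "u @ [False, False]"] h(2)[OF AB(1) u] h(2)[OF AB(2) u] by simp
      also have "\<dots> = u @ [False, u \<in> B]"
        using H(2) x(1) u by (auto simp: level_stabilizer_def)
      finally show ?thesis by simp
    qed
    then show "A = B" using AB by blast
  qed
  have "(\<lambda>A. H #>\<^bsub>grigorchuk_group\<^esub> h A) ` Pow ?L \<subseteq> rcosets\<^bsub>grigorchuk_group\<^esub> H"
    using grig.rcosetsI[OF subgroup.subset[OF H(1)]] h(1) by blast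
  from card_inj_on_le[OF inj this] H(3) show ?thesis
    using card_bool_words[of j] by (simp add: finite_index_def subgroup_index_def card_Pow)
qed

section \<open>The number of generators from below\<close>

text \<open>A vector assigns to each vertex a function with values in the field of two elements,
  rather than a scalar; thus one vector can record a whole permutation of a level.\<close>

inductive_set bit_span :: "(bool list \<Rightarrow> bool list \<Rightarrow> bit) set \<Rightarrow> (bool list \<Rightarrow> bool list \<Rightarrow> bit) set"
  for B where
    zero: "0 \<in> bit_span B"
  | add: "b \<in> B \<Longrightarrow> x \<in> bit_span B \<Longrightarrow> b + x \<in> bit_span B"

lemma bit_fun_add_self: "x + x = (0 :: bool list \<Rightarrow> bit)" "y + y = (0 :: bool list \<Rightarrow> bool list \<Rightarrow> bit)"
  by (auto simp: fun_eq_iff)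

lemma bit_fun_add_cancel: "x + y + y = x" for x y :: "bool list \<Rightarrow> bit"
  by (simp only: add.assoc bit_fun_add_self add_0_right)

lemma bit_span_base: "b \<in> B \<Longrightarrow> b \<in> bit_span B"
  using bit_span.add[OF _ bit_span.zero] by force

lemma bit_span_add: "x \<in> bit_span B \<Longrightarrow> y \<in> bit_span B \<Longrightarrow> x + y \<in> bit_span B"
  by (induction rule: bit_span.induct) (simp_all add: add.assoc bit_span.add)

text \<open>A base element added twice cancels, so every member of the span is the sum of a subset
  of \<open>B\<close>.\<close>

lemma bit_span_subset_sums:
  assumes "finite B"
  shows "bit_span B \<subseteq> (\<lambda>U. \<Sum>U) ` Pow B"
proof
  fix x assume "x \<in> bit_span B"
  then show "x \<in> (\<lambda>U. \<Sum>U) ` Pow B"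
  proof induction
    case zero
    have "0 = \<Sum>({} :: (bool list \<Rightarrow> bool list \<Rightarrow> bit) set)" by simp
    then show ?case by blast
  next
    case (add b x)
    then obtain U where U: "U \<subseteq> B" "x = \<Sum>U" by blast
    then have fin: "finite U" using assms finite_subset by blast
    show ?case
    proof (cases "b \<in> U")
      case True
      have "b + x = \<Sum>(U - {b})"
        unfolding U(2) sum.remove[OF fin True] by (simp add: add.assoc[symmetric] bit_fun_add_self)
      then show ?thesis using U(1) by blast
    next
      case False
      then have "b + x = \<Sum>(insert b U)"
        using fin U(2) by simp
      then show ?thesis using U(1) add.hyps(1) by blast
    qed
  qed
qed

lemma card_bit_span:
  assumes "finite B"
  shows "finite (bit_span B)" "card (bit_span B) \<le> 2 ^ card B"
proof -
  have "card ((\<lambda>U. \<Sum>U) ` Pow B) \<le> 2 ^ card B"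
    using card_image_le[of "Pow B" "\<lambda>U. \<Sum>U"] assms by (simp add: card_Pow)
  then show "finite (bit_span B)" "card (bit_span B) \<le> 2 ^ card B"
    using finite_subset[OF bit_span_subset_sums] card_mono[OF _ bit_span_subset_sums] assms
    by (auto intro: order_trans)
qed

section \<open>Difference operators and their nilpotency\<close>

text \<open>The operator \<open>x - 1\<close>, where \<open>x\<close> acts on functions by
  substitution; in characteristic 2 the difference is a sum.\<close>

definition diff_op :: "(bool list \<Rightarrow> bool list) \<Rightarrow> (bool list \<Rightarrow> bool list \<Rightarrow> bit) \<Rightarrow> bool list \<Rightarrow> bool list \<Rightarrow> bit" where
  "diff_op x f v = f (x v) + f v"

definition sibling_sum :: "(bool list \<Rightarrow> bool list \<Rightarrow> bit) \<Rightarrow> bool list \<Rightarrow> bool list \<Rightarrow> bit" where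
  "sibling_sum f w = f (w @ [False]) + f (w @ [True])"

text \<open>\<open>x\<close> maps the two children of \<open>w\<close> onto the two children of
  \<open>x w\<close>, so summing over children carries functions to the preceding level compatibly
  with the action.\<close>

lemma sibling_sum_diff_op:
  assumes "x \<in> Grig"
  shows "sibling_sum (diff_op x f) = diff_op x (sibling_sum f)"
proof
  fix w
  obtain s where s: "s \<in> Grig" "\<And>v. x (w @ v) = x w @ s v"
    using Grig_section[OF assms] by blast
  obtain e s0 s1 where e: "s0 \<in> Grig" "s1 \<in> Grig" "\<And>v. s (False # v) = e # s0 v" "\<And>v. s (True # v) = (\<not> e) # s1 v"
    using Grig_decompose[OF s(1)] by blast
  have "x (w @ [False]) = x w @ [e]" "x (w @ [True]) = x w @ [\<not> e]"
    using s(2) e by (simp_all add: Grig_Nil)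
  then show "sibling_sum (diff_op x f) w = diff_op x (sibling_sum f) w"
    by (cases e) (simp_all add: sibling_sum_def diff_op_def algebra_simps)
qed

lemma sibling_sum_foldr:
  "set us \<subseteq> Grig \<Longrightarrow> sibling_sum (foldr diff_op us f) = foldr diff_op us (sibling_sum f)"
  by (induction us) (simp_all add: sibling_sum_diff_op)

text \<open>A function that ignores the last letter is a function on the preceding level, with the
  same action.\<close>

lemma foldr_diff_op_pullback:
  assumes "set us \<subseteq> Grig" and "\<And>v. length v = Suc n \<Longrightarrow> f v = h (take n v)" and "length v = Suc n"
  shows "foldr diff_op us f v = foldr diff_op us h (take n v)"
  using assms(1,3)
proof (induction us arbitrary: v)
  case Nil
  then show ?case using assms(2) by simp
next
  case (Cons x us)
  then have x: "x \<in> Grig" by simp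
  obtain s where s: "s \<in> Grig" "\<And>y. x (take n v @ y) = x (take n v) @ s y"
    using Grig_section[OF x] by blast
  have "x v = x (take n v) @ s (drop n v)"
    using s(2)[of "drop n v"] by simp
  then have "take n (x v) = x (take n v)"
    using Grig_length[OF x, of "take n v"] Cons.prems(2) by simp
  moreover have "length (x v) = Suc n"
    using Grig_length[OF x, of v] Cons.prems(2) by simp
  ultimately show ?case
    using Cons by (simp add: diff_op_def)
qed

text \<open>
  An iterated extension of groups of order 2 acts unipotently on the functions over \<open>F\<^sub>2\<close>, and
  the nilpotency degree at most doubles with each level.
\<close>

lemma foldr_diff_op_vanishes:
  assumes "set us \<subseteq> Grig \<inter> level_stabilizer n" "length us = 2 ^ m" "length v = n + m"
  shows "foldr diff_op us f v = 0"
  using assms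
proof (induction m arbitrary: us f v)
  case 0
  then obtain x where "us = [x]" "x v = v"
    by (auto simp: length_Suc_conv level_stabilizer_def)
  then show ?case
    by (simp only: foldr.simps comp_apply id_apply diff_op_def bit_fun_add_self)
next
  case (Suc m)
  define p q where "p = take (2 ^ m) us" and "q = drop (2 ^ m) us"
  have us: "us = p @ q" and len: "length p = 2 ^ m" "length q = 2 ^ m"
    using Suc.prems(2) by (simp_all add: p_def q_def)
  have st: "set p \<subseteq> Grig \<inter> level_stabilizer n" "set q \<subseteq> Grig \<inter> level_stabilizer n"
    using Suc.prems(1) us by simp_all
  have G: "set p \<subseteq> Grig" "set q \<subseteq> Grig"
    using st by auto
  define F where "F = foldr diff_op q f"
  \<comment> \<open>By the induction hypothesis the half \<open>q\<close>, which is applied first,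
    annihilates sibling sums. So \<open>F\<close> takes equal values on siblings and comes from a
    function on level \<open>n + m\<close>, which the half \<open>p\<close> annihilates.\<close>
  have sib: "F (w @ [False]) = F (w @ [True])" if "length w = n + m" for w
  proof -
    have "sibling_sum F w = 0"
      unfolding F_def sibling_sum_foldr[OF G(2)] by (rule Suc.IH[OF st(2) len(2) that])
    then have "F (w @ [False]) + F (w @ [True]) + F (w @ [True]) = F (w @ [True])"
      by (simp add: sibling_sum_def)
    then show ?thesis
      by (simp add: add.assoc bit_fun_add_self)
  qed
  define h where "h w = F (w @ [False])" for w
  have "F v = h (take (n + m) v)" if v: "length v = Suc (n + m)" for v
  proof -
    obtain w b where "v = w @ [b]" using v by (cases v rule: rev_cases) auto
    then show ?thesis using sib[of w] v by (cases b) (simp_all add: h_def)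
  qed
  then have "foldr diff_op p F v = foldr diff_op p h (take (n + m) v)"
    using Suc.prems(3) by (intro foldr_diff_op_pullback[OF G(1)]) auto
  also have "\<dots> = 0"
    using Suc.prems(3) by (intro Suc.IH st(1) len(1)) simp
  finally show ?case
    by (simp add: us F_def)
qed

section \<open>Counting the actions on a level\<close>

definition on_level :: "nat \<Rightarrow> (bool list \<Rightarrow> bool list \<Rightarrow> bit) \<Rightarrow> bool list \<Rightarrow> bool list \<Rightarrow> bit" where
  "on_level n f v = (if length v = n then f v else 0)"

text \<open>All indicator functions in one vector; composed with \<open>g\<close> it becomes the
  permutation matrix of \<open>g\<close>, which determines \<open>g\<close>.\<close>

definition dirac :: "bool list \<Rightarrow> bool list \<Rightarrow> bit" where
  "dirac v w = (if v = w then 1 else 0)"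

text \<open>The left side is the number of words of length at most \<open>k\<close> over
  \<open>a\<close> letters.\<close>

lemma sum_powers_le: "(\<Sum>i\<le>k. a ^ i) \<le> (a + 1) ^ k" for a :: nat
proof (induction k)
  case (Suc k)
  have "a ^ Suc k \<le> a * (a + 1) ^ k"
    by (simp add: power_mono)
  with Suc have "(\<Sum>i\<le>k. a ^ i) + a ^ Suc k \<le> (a + 1) ^ k + a * (a + 1) ^ k"
    by (rule add_mono)
  then show ?case by simp
qed simp

text \<open>
  Writing \<open>g = 1 + (g - 1)\<close> for the generators and expanding, every element of the group acts on
  the given level as a sum of products of fewer than \<open>2 ^ m\<close> operators \<^const>\<open>diff_op\<close>.
\<close>

lemma level_action_in_bit_span:
  assumes A: "A \<subseteq> Grig \<inter> level_stabilizer n" "\<And>x. x \<in> A \<Longrightarrow> finv x \<in> A"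
    and g: "g \<in> generate grigorchuk_group A"
  shows "on_level (n + m) (f \<circ> g)
    \<in> bit_span ((\<lambda>us. on_level (n + m) (foldr diff_op us f)) ` {us. set us \<subseteq> A \<and> length us < 2 ^ m})"
    (is "_ \<in> bit_span (?b ` ?W)")
proof -
  have AG: "A \<subseteq> Grig" using A(1) by blast
  let ?T = "\<lambda>x F. on_level (n + m) (F \<circ> x)"
  have gen: "?T x F \<in> bit_span (?b ` ?W)" if x: "x \<in> A" and F: "F \<in> bit_span (?b ` ?W)" for x F
    using F
  proof induction
    case zero
    have "?T x 0 = 0" by (simp add: fun_eq_iff on_level_def)
    then show ?case by (simp only: bit_span.zero)
  next
    case (add b F)
    then obtain us where us: "us \<in> ?W" "b = ?b us" by blast
    have xG: "x \<in> Grig" using x AG by blast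
    have "?T x b = ?b (x # us) + ?b us"
      unfolding us(2)
      by (rule ext) (simp add: on_level_def diff_op_def Grig_length[OF xG] bit_fun_add_cancel)
    \<comment> \<open>The word with one more letter is either still shorter than
      \<open>2 ^ m\<close>, or has exactly this length and then its operator vanishes on level
      \<open>n + m\<close>.\<close>
    moreover have "?b (x # us) \<in> bit_span (?b ` ?W)"
    proof (cases "length (x # us) < 2 ^ m")
      case True
      then have "x # us \<in> ?W" using us(1) x by simp
      then show ?thesis by (intro bit_span_base imageI)
    next
      case False
      then have "length (x # us) = 2 ^ m" using us(1) by simp
      moreover have "set (x # us) \<subseteq> Grig \<inter> level_stabilizer n"
        using us(1) x A(1) by auto
      ultimately have vanish: "foldr diff_op (x # us) f v = 0" if "length v = n + m" for v
        using that by (intro foldr_diff_op_vanishes)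
      have "?b (x # us) v = 0" for v
        unfolding on_level_def by (cases "length v = n + m") (simp_all only: vanish simp_thms if_True if_False)
      then have "?b (x # us) = 0"
        by (intro ext[where f = "?b (x # us)"]) (simp only: zero_fun_def)
      then show ?thesis by (simp only: bit_span.zero)
    qed
    moreover have "?b us \<in> bit_span (?b ` ?W)"
      using us(1) by (intro bit_span_base imageI)
    ultimately have "?T x b \<in> bit_span (?b ` ?W)"
      by (simp only: bit_span_add)
    then have "?T x b + ?T x F \<in> bit_span (?b ` ?W)"
      by (rule bit_span_add[OF _ add.IH])
    moreover have "?T x (b + F) = ?T x b + ?T x F"
      by (rule ext) (simp add: on_level_def)
    ultimately show ?case by (simp only:)
  qed
  \<comment> \<open>Invariance of the whole span is proved, since a product in the group acts one
    factor after the other.\<close>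
  have "?T g F \<in> bit_span (?b ` ?W)" if "F \<in> bit_span (?b ` ?W)" for F
    using g that
  proof (induction arbitrary: F)
    case one
    have "?T id F = F" if "F \<in> bit_span (?b ` ?W)" for F
      using that
    proof induction
      case zero
      show ?case by (rule ext) (simp add: on_level_def zero_fun_def)
    next
      case (add b F)
      have "?T id b = b"
        using add.hyps(1) by (auto simp: on_level_def)
      moreover have "?T id (b + F) = ?T id b + ?T id F"
        by (rule ext) (simp add: on_level_def)
      ultimately show ?case using add.IH by (simp only:)
    qed
    then show ?case using one by (simp only: Grig_one)
  next
    case (incl x)
    then show ?case by (rule gen)
  next
    case (inv x)
    then have "inv\<^bsub>grigorchuk_group\<^esub> x = finv x" using AG by auto
    then show ?case using gen[OF A(2)[OF inv(1)] inv(2)] by (simp only:)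
  next
    case (eng g h)
    then have G: "g \<in> Grig" "h \<in> Grig"
      using grig.generate_in_carrier[OF AG] by blast+
    have "?T (g \<circ> h) F = ?T h (?T g F)"
      by (simp add: fun_eq_iff on_level_def Grig_length[OF G(2)])
    then show ?case
      using eng.IH(2)[OF eng.IH(1)[OF eng.prems]] by (simp only: Grig_mult[OF G])
  qed
  moreover have "?b [] \<in> bit_span (?b ` ?W)"
    by (intro bit_span_base imageI) simp
  ultimately have "?T g (?b []) \<in> bit_span (?b ` ?W)" by blast
  moreover have "g \<in> Grig" using grig.generate_in_carrier[OF AG g] .
  then have "?T g (?b []) = on_level (n + m) (f \<circ> g)"
    by (simp add: fun_eq_iff on_level_def Grig_length)
  ultimately show ?thesis by simp
qed

text \<open>The flips give \<open>2 ^ 2 ^ j\<close> different actions on level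
  \<open>j + 2 = n + m\<close>. All of them lie in the span of at most
  \<open>(2 * card S + 1) ^ 2 ^ m\<close> vectors, and comparing exponents of 2 gives the
  claim.\<close>

lemma rank_lower_bound:
  assumes S: "finite S" "S \<subseteq> Grig" and st: "generate grigorchuk_group S \<subseteq> level_stabilizer n"
    and below: "\<And>u. length u = j \<Longrightarrow> below u elt_t \<in> generate grigorchuk_group S"
    and jm: "j + 2 = n + m"
  shows "2 ^ j \<le> (2 * card S + 1) ^ 2 ^ m"
proof -
  let ?H = "generate grigorchuk_group S" and ?L = "{u :: bool list. length u = j}"
  have subH: "subgroup ?H grigorchuk_group" by (rule grig.generate_is_subgroup[OF S(2)])
  then have cl: "id \<in> ?H" "\<And>x y. x \<in> ?H \<Longrightarrow> y \<in> ?H \<Longrightarrow> x \<circ> y \<in> ?H" "\<And>x. x \<in> ?H \<Longrightarrow> finv x \<in> ?H" "?H \<subseteq> Grig"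
    by (simp_all add: subgroup_Grig_iff)
  \<comment> \<open>Closing \<open>S\<close> under inverses at most doubles the number of
    letters.\<close>
  define A where "A = S \<union> finv ` S"
  have SH: "S \<subseteq> ?H" by (blast intro: generate.incl)
  then have "A \<subseteq> ?H" using cl(3) by (auto simp: A_def)
  then have AG: "A \<subseteq> Grig \<inter> level_stabilizer n" using cl(4) st by blast
  have Ai: "finv x \<in> A" if "x \<in> A" for x
    using that S(2) by (auto simp: A_def inv_inv_eq Grig_bij)
  have Afin: "finite A" "card A \<le> 2 * card S"
    using S(1) card_Un_le[of S "finv ` S"] card_image_le[OF S(1), of finv] by (auto simp: A_def)
  define B where "B = (\<lambda>us. on_level (n + m) (foldr diff_op us dirac)) ` {us. set us \<subseteq> A \<and> length us < 2 ^ m}"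
  define W where "W = {us. set us \<subseteq> A \<and> length us \<le> 2 ^ m}"
  have W: "finite W" "card W \<le> (2 * card S + 1) ^ 2 ^ m"
  proof -
    show "finite W" unfolding W_def by (rule finite_lists_length_le[OF Afin(1)])
    have "card W \<le> (card A + 1) ^ 2 ^ m"
      unfolding W_def card_lists_length_le[OF Afin(1)] by (rule sum_powers_le)
    also have "\<dots> \<le> (2 * card S + 1) ^ 2 ^ m"
      using Afin(2) by (intro power_mono) simp_all
    finally show "card W \<le> (2 * card S + 1) ^ 2 ^ m" .
  qed
  have sub: "{us. set us \<subseteq> A \<and> length us < 2 ^ m} \<subseteq> W" by (auto simp: W_def)
  then have fin: "finite {us. set us \<subseteq> A \<and> length us < 2 ^ m}" using W(1) finite_subset by blast
  have B: "finite B" "card B \<le> (2 * card S + 1) ^ 2 ^ m"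
  proof -
    show "finite B" unfolding B_def using fin by (rule finite_imageI)
    have "card B \<le> card {us. set us \<subseteq> A \<and> length us < 2 ^ m}"
      unfolding B_def by (rule card_image_le[OF fin])
    also have "\<dots> \<le> card W" by (rule card_mono[OF W(1) sub])
    finally show "card B \<le> (2 * card S + 1) ^ 2 ^ m" using W(2) by simp
  qed
  have in_span: "on_level (n + m) (dirac \<circ> g) \<in> bit_span B" if "g \<in> ?H" for g
    unfolding B_def
  proof (rule level_action_in_bit_span[OF AG Ai])
    show "g \<in> generate grigorchuk_group A"
      using that grig.mono_generate[of S A] by (auto simp: A_def)
  qed
  have "\<forall>U\<in>Pow ?L. \<exists>g. g \<in> ?H \<and> (\<forall>u. length u = j \<longrightarrow> g (u @ [False, False]) = u @ [False, u \<in> U])"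
  proof
    fix U assume "U \<in> Pow ?L"
    then have "U \<subseteq> ?L" by (rule PowD)
    from independent_flips[OF cl(1,2) below this]
    show "\<exists>g. g \<in> ?H \<and> (\<forall>u. length u = j \<longrightarrow> g (u @ [False, False]) = u @ [False, u \<in> U])"
      by (simp only: Bex_def)
  qed
  from bchoice[OF this] obtain h where hh: "\<forall>U\<in>Pow ?L. h U \<in> ?H \<and>
    (\<forall>u. length u = j \<longrightarrow> h U (u @ [False, False]) = u @ [False, u \<in> U])" ..
  have h: "h U \<in> ?H" "length u = j \<Longrightarrow> h U (u @ [False, False]) = u @ [False, u \<in> U]"
    if "U \<in> Pow ?L" for U u
    using bspec[OF hh that] by blast+
  have inj: "inj_on (\<lambda>U. on_level (n + m) (dirac \<circ> h U)) (Pow ?L)"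
  proof (rule inj_onI)
    fix U V assume UV: "U \<in> Pow ?L" "V \<in> Pow ?L"
      and eq: "on_level (n + m) (dirac \<circ> h U) = on_level (n + m) (dirac \<circ> h V)"
    have "u \<in> U \<longleftrightarrow> u \<in> V" if u: "length u = j" for u
    proof -
      have "dirac (h U (u @ [False, False])) = dirac (h V (u @ [False, False]))"
        using fun_cong[OF eq, of "u @ [False, False]"] u jm by (simp add: on_level_def)
      then have "dirac (u @ [False, u \<in> U]) (u @ [False, u \<in> U]) = dirac (u @ [False, u \<in> V]) (u @ [False, u \<in> U])"
        using h(2)[OF UV(1) u] h(2)[OF UV(2) u] by simp
      then show ?thesis by (auto simp: dirac_def split: if_splits)
    qed
    then show "U = V" using UV by blast
  qed
  have "(\<lambda>U. on_level (n + m) (dirac \<circ> h U)) ` Pow ?L \<subseteq> bit_span B"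
    using in_span h(1) by blast
  from card_inj_on_le[OF inj this card_bit_span(1)[OF B(1)]]
  have "2 ^ 2 ^ j \<le> card (bit_span B)"
    using card_bool_words[of j] by (simp add: card_Pow)
  also have "\<dots> \<le> 2 ^ card B" by (rule card_bit_span(2)[OF B(1)])
  finally have "(2::nat) ^ 2 ^ j \<le> 2 ^ card B" .
  then have "2 ^ j \<le> card B" by simp
  then show ?thesis using B(2) by simp
qed

section \<open>Normal subgroups\<close>

text \<open>Since \<open>log 2 0 = 0\<close>, the double logarithm takes the value 0 at 0 and 1.
  From 2 on the inner logarithm is at least 1, so the values are nonnegative and monotonicity holds
  from 0 on.\<close>

lemma loglog_mono:
  fixes m n :: nat
  assumes "m \<le> n"
  shows "log 2 (log 2 (real m)) \<le> log 2 (log 2 (real n))"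
proof (cases "m \<le> 1")
  case True
  then have "m = 0 \<or> m = 1" by auto
  then have m: "log 2 (log 2 (real m)) = 0" by (auto simp: log_def)
  show ?thesis
  proof (cases "n \<le> 1")
    case True
    then have "n = 0 \<or> n = 1" by auto
    then show ?thesis using m by (auto simp: log_def)
  next
    case False
    then have "1 \<le> log 2 (real n)" by (simp add: le_log_iff)
    then show ?thesis using m by simp
  qed
next
  case False
  then have "0 < log 2 (real m)" "log 2 (real m) \<le> log 2 (real n)" using assms by simp_all
  then show ?thesis by simp
qed

lemma loglog_power: "log 2 (log 2 (real (2 ^ 2 ^ k))) = k"
proof -
  have "log 2 (real (2 ^ 2 ^ k)) = real (2 ^ k)"
    by (simp add: log_nat_power)
  then show ?thesis by (simp add: log_nat_power)
qed

lemma nat_log_mono: "m \<le> n \<Longrightarrow> log 2 (real m) \<le> log 2 (real n)" for m n :: nat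
proof (cases "m = 0")
  case True
  then have "log 2 (real m) = 0" by (simp add: log_def)
  then show ?thesis by (cases "n = 0") (simp_all add: log_def)
qed simp

lemma mono_filterlim_at_top:
  fixes f :: "nat \<Rightarrow> real"
  assumes "mono f" "\<And>k :: nat. \<exists>N. real k \<le> f N"
  shows "filterlim f at_top sequentially"
  unfolding filterlim_at_top
proof
  fix Z :: real
  obtain k :: nat where "Z \<le> real k" using real_arch_simple by blast
  then obtain N where "Z \<le> f N" using assms(2) order_trans by blast
  then have "Z \<le> f n" if "N \<le> n" for n using monoD[OF assms(1) that] by linarith
  then show "\<forall>\<^sub>F n in sequentially. Z \<le> f n" by (rule eventually_sequentiallyI)
qed

section \<open>Rank and index of nontrivial normal subgroups\<close>

text \<open>A group with at most one generator is cyclic and hence commutative. This will make the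
  logarithm of the rank at least 1, so that it can absorb constants.\<close>

lemma generate_not_commutative:
  assumes S: "finite S" "S \<subseteq> Grig"
    and xy: "x \<in> generate grigorchuk_group S" "y \<in> generate grigorchuk_group S" "x \<circ> y \<noteq> y \<circ> x"
  shows "2 \<le> card S"
proof (rule ccontr)
  assume "\<not> 2 \<le> card S"
  then have "card S \<le> 1" by simp
  then obtain z where z: "z \<in> Grig" "S \<subseteq> {z}"
    using S Grig_id by (metis card_1_singletonE card_eq_0_iff empty_subsetI insert_subset le_antisym
        less_one not_le order_refl)
  have sub: "generate grigorchuk_group S \<subseteq> generate grigorchuk_group {z}"
    by (rule grig.mono_generate[OF z(2)])
  then obtain k l :: int where "x = z [^]\<^bsub>grigorchuk_group\<^esub> k" "y = z [^]\<^bsub>grigorchuk_group\<^esub> l"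
    using xy(1,2) grig.generate_pow[OF z(1)] by blast
  then have "x \<otimes>\<^bsub>grigorchuk_group\<^esub> y = y \<otimes>\<^bsub>grigorchuk_group\<^esub> x"
    by (simp only: grig.int_pow_mult[OF z(1), symmetric] add.commute)
  moreover have "x \<in> Grig" "y \<in> Grig"
    using xy(1,2) grig.generate_in_carrier[OF S(2)] by blast+
  ultimately show False using xy(3) by simp
qed

lemma below_elt_t_not_commutative:
  "below u elt_t \<circ> below u (below [False] elt_t) \<noteq> below u (below [False] elt_t) \<circ> below u elt_t"
proof
  assume "below u elt_t \<circ> below u (below [False] elt_t) = below u (below [False] elt_t) \<circ> below u elt_t"
  \<comment> \<open>Inside the subtree of \<open>u\<close> the two products differ by a copy of
    \<open>t\<close> below 01, which first shows on words of length 4.\<close>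
  from fun_cong[OF this, of "u @ [False, False, False, False]"] show False
    by (simp add: below_Cons elt_t_def)
qed

lemma min_generators_witness:
  assumes "finite S" "S \<subseteq> H" "generate G S = H"
  shows "min_generators G H \<le> card S"
    "\<exists>T. finite T \<and> card T = min_generators G H \<and> T \<subseteq> H \<and> generate G T = H"
proof -
  show "min_generators G H \<le> card S"
    unfolding min_generators_def using assms by (intro Least_le) blast
  show "\<exists>T. finite T \<and> card T = min_generators G H \<and> T \<subseteq> H \<and> generate G T = H"
    unfolding min_generators_def by (rule LeastI[of _ "card S"]) (use assms in blast)
qed

text \<open>The subgroup contains \<open>K_level (n + 3)\<close>, and
  \<open>5 * 2 ^ (n + 3) <= 2 ^ (n + 6)\<close> gives the upper bound on the index. The lower bound
  on the index uses flips below level \<open>n - 2\<close>, visible on level \<open>n\<close>; hence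
  the alternative \<open>n < 2\<close>.\<close>

lemma normal_subgroup_estimates:
  assumes H: "H \<lhd> grigorchuk_group" "H \<noteq> {id}"
  obtains n where "finite_index grigorchuk_group H" "1 \<le> subgroup_index grigorchuk_group H"
    "2 ^ 2 ^ (n - 2) \<le> subgroup_index grigorchuk_group H \<or> n < 2"
    "subgroup_index grigorchuk_group H \<le> 2 ^ 2 ^ (n + 6)"
    "2 \<le> min_generators grigorchuk_group H" "min_generators grigorchuk_group H \<le> 2 ^ (n + 6)"
    "2 ^ (n + 3) \<le> min_generators grigorchuk_group H ^ 96"
proof -
  let ?r = "min_generators grigorchuk_group H" and ?i = "subgroup_index grigorchuk_group H"
  have subH: "subgroup H grigorchuk_group" using H(1) by (simp add: normal_Grig_iff)
  have HG: "H \<subseteq> Grig" using subgroup.subset[OF subH] .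
  obtain n where n: "H \<subseteq> level_stabilizer n"
    "\<And>u x. length u = n + 3 \<Longrightarrow> x \<in> K_gens \<Longrightarrow> below u x \<in> H"
    using normal_level[OF H] by blast
  have K: "K_level_gens (n + 3) \<subseteq> H" using n(2) by (auto simp: K_level_gens_def)
  then have "K_level (n + 3) \<subseteq> H"
    unfolding K_level_def by (rule grig.generate_subgroup_incl[OF _ subH])
  moreover obtain q where q: "coset_bound (K_level (n + 3)) q" "2 * q \<le> 2 ^ (5 * 2 ^ (n + 3))"
    using coset_bound_K_level by blast
  ultimately have "coset_bound H q" using coset_bound_mono by blast
  from coset_bound_rcosets[OF subH this] have fin: "finite_index grigorchuk_group H" and "?i \<le> q" .
  have "rcosets\<^bsub>grigorchuk_group\<^esub> H \<noteq> {}"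
    using grig.rcosetsI[OF HG grig.one_closed] by blast
  then have i1: "1 \<le> ?i"
    using fin by (simp add: finite_index_def subgroup_index_def Suc_le_eq card_gt_0_iff)
  have "?i \<le> 2 ^ (5 * 2 ^ (n + 3))" using \<open>?i \<le> q\<close> q(2) by simp
  also have "\<dots> \<le> 2 ^ 2 ^ (n + 6)" by (intro power_increasing) (simp_all add: power_add)
  finally have i_le: "?i \<le> 2 ^ 2 ^ (n + 6)" .
  have i_ge: "2 ^ 2 ^ (n - 2) \<le> ?i \<or> n < 2"
  proof (cases "n < 2")
    case False
    then have "n - 2 + 2 = n" by simp
    then show ?thesis
      using index_lower_bound[OF subH, of "n - 2"] n(1) fin by (simp only: simp_thms)
  qed simp
  obtain S where S: "finite S" "S \<subseteq> H" "generate grigorchuk_group S = H" "card S \<le> 2 ^ (n + 3 + 3)"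
    using generators_over_K_level[OF subH K] by blast
  have "n + 3 + 3 = n + 6" by simp
  with S(4) have S_le: "card S \<le> 2 ^ (n + 6)" by (simp only:)
  have r_le: "?r \<le> 2 ^ (n + 6)"
    by (rule order_trans[OF min_generators_witness(1)[OF S(1-3)] S_le])
  obtain T where T: "finite T" "card T = ?r" "T \<subseteq> H" "generate grigorchuk_group T = H"
    using min_generators_witness(2)[OF S(1-3)] by blast
  have TG: "T \<subseteq> Grig" using T(3) HG by blast
  define u where "u = replicate (n + 3) False"
  have tv: "elt_t \<in> K_gens" "below [False] elt_t \<in> K_gens" by (simp_all add: K_gens_def)
  have "below u elt_t \<in> generate grigorchuk_group T" "below u (below [False] elt_t) \<in> generate grigorchuk_group T"
    unfolding T(4) by (rule n(2), simp add: u_def, rule tv)+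
  from generate_not_commutative[OF T(1) TG this below_elt_t_not_commutative]
  have r2: "2 \<le> ?r" using T(2) by simp
  \<comment> \<open>Flips below level \<open>n + 3\<close> are visible on level
    \<open>n + 5\<close>, five levels below the fixed one; so \<open>m = 5\<close>.\<close>
  have "2 ^ (n + 3) \<le> (2 * card T + 1) ^ 2 ^ 5"
  proof (rule rank_lower_bound[OF T(1) TG])
    show "generate grigorchuk_group T \<subseteq> level_stabilizer n" using T(4) n(1) by simp
    show "below u elt_t \<in> generate grigorchuk_group T" if "length u = n + 3" for u
      using n(2)[OF that tv(1)] T(4) by simp
  qed simp
  \<comment> \<open>This simplifies the base to the rank alone; the exponent becomes
    \<open>3 * 32 = 96\<close>.\<close>
  also have "2 * ?r + 1 \<le> ?r ^ 3"
  proof -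
    have "2 * ?r + 1 \<le> 2 * 2 * ?r" using r2 by simp
    also have "\<dots> \<le> ?r * ?r * ?r" using r2 by (intro mult_le_mono) simp_all
    finally show ?thesis by (simp add: power3_eq_cube)
  qed
  then have "(2 * card T + 1) ^ 2 ^ 5 \<le> (?r ^ 3) ^ 2 ^ 5"
    unfolding T(2) by (rule power_mono) simp
  also have "\<dots> = ?r ^ 96" by (simp flip: power_mult)
  finally have "2 ^ (n + 3) \<le> ?r ^ 96" .
  with that[OF fin i1 i_ge i_le r2 r_le] show ?thesis by blast
qed

lemma normal_subgroup_log_estimates:
  assumes H: "H \<lhd> grigorchuk_group" "H \<noteq> {id}"
  defines "i \<equiv> subgroup_index grigorchuk_group H" and "r \<equiv> min_generators grigorchuk_group H"
  shows "finite_index grigorchuk_group H" "1 \<le> i" "1 \<le> log 2 (real r)"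
    "log 2 (log 2 (real i)) \<le> 192 * log 2 (real r)"
    "log 2 (real r) \<le> 8 \<or> log 2 (real r) \<le> 9 * log 2 (log 2 (real i))"
proof -
  obtain n where n: "finite_index grigorchuk_group H" "1 \<le> i" "2 ^ 2 ^ (n - 2) \<le> i \<or> n < 2"
    "i \<le> 2 ^ 2 ^ (n + 6)" "2 \<le> r" "r \<le> 2 ^ (n + 6)" "2 ^ (n + 3) \<le> r ^ 96"
    using normal_subgroup_estimates[OF H] unfolding i_def r_def by blast
  show "finite_index grigorchuk_group H" "1 \<le> i" by fact+
  show "1 \<le> log 2 (real r)" using n(5) by (simp add: le_log_iff)
  have "log 2 (real (2 ^ (n + 3))) \<le> log 2 (real (r ^ 96))"
    by (rule nat_log_mono[OF n(7)])
  then have r_ge: "real (n + 3) \<le> 96 * log 2 (real r)"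
    using n(5) by (simp add: log_nat_power)
  have r_le: "log 2 (real r) \<le> real (n + 6)"
    using nat_log_mono[OF n(6)] by (simp add: log_nat_power)
  have "log 2 (log 2 (real i)) \<le> real (n + 6)"
    using loglog_mono[OF n(4)] by (simp only: loglog_power)
  \<comment> \<open>\<open>n + 6 <= 2 * (n + 3)\<close>, and twice 96 is 192.\<close>
  then show "log 2 (log 2 (real i)) \<le> 192 * log 2 (real r)"
    using r_ge by simp
  \<comment> \<open>\<open>n + 6\<close> is at most 8 for \<open>n <= 2\<close>, and at most
    \<open>9 * (n - 2)\<close> for \<open>n >= 3\<close>.\<close>
  show "log 2 (real r) \<le> 8 \<or> log 2 (real r) \<le> 9 * log 2 (log 2 (real i))"
  proof (cases "n \<le> 2")
    case True
    then show ?thesis using r_le by simp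
  next
    case False
    then have "2 ^ 2 ^ (n - 2) \<le> i" using n(3) by simp
    from loglog_mono[OF this] have "real (n - 2) \<le> log 2 (log 2 (real i))"
      by (simp only: loglog_power)
    then show ?thesis using r_le False by simp
  qed
qed

text \<open>The trivial subgroup fixes every level, so a finite index would be at least
  \<open>2 ^ 2 ^ j\<close> for every \<open>j\<close>; taking the index itself for \<open>j\<close>
  is contradictory.\<close>

lemma finite_index_imp_nontrivial:
  assumes "H \<lhd> grigorchuk_group" "finite_index grigorchuk_group H"
  shows "H \<noteq> {id}"
proof
  assume "H = {id}"
  then have "H \<subseteq> level_stabilizer (j + 2)" for j by (simp add: level_stabilizer_def)
  moreover have "subgroup H grigorchuk_group" using assms(1) by (simp add: normal_Grig_iff)
  ultimately have "2 ^ 2 ^ subgroup_index grigorchuk_group H \<le> subgroup_index grigorchuk_group H"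
    using index_lower_bound assms(2) by blast
  moreover have "k < 2 ^ 2 ^ k" for k :: nat
    by (meson less_exp less_trans)
  ultimately show False by (simp add: not_le[symmetric])
qed

text \<open>The lower estimate is restricted to index greater than 2: for index 1 or 2 the double
  logarithm has the value 0, while the logarithm of the rank is at least 1. Finiteness of the index
  is part of the conclusion, as it gives \<open>subgroup_index\<close> its meaning.\<close>

theorem theorem1p2:
  shows "normally_RG_rigid (\<lambda>n. log 2 (log 2 (real n))) (\<lambda>n. log 2 (real n)) grigorchuk_group \<and>
    (\<exists>D::real. D > 1 \<and>
      (\<forall>H. H \<lhd> grigorchuk_group \<and> H \<noteq> {\<one>\<^bsub>grigorchuk_group\<^esub>} \<longrightarrow>
         finite_index grigorchuk_group H \<and>
         (subgroup_index grigorchuk_group H > 2 \<longrightarrow>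
            1 / D * log 2 (real (min_generators grigorchuk_group H))
              \<le> log 2 (log 2 (real (subgroup_index grigorchuk_group H)))) \<and>
         log 2 (log 2 (real (subgroup_index grigorchuk_group H)))
           \<le> D * log 2 (real (min_generators grigorchuk_group H))))"
proof (intro conjI)
  let ?i = "subgroup_index grigorchuk_group" and ?r = "min_generators grigorchuk_group"
  show "normally_RG_rigid (\<lambda>n. log 2 (log 2 (real n))) (\<lambda>n. log 2 (real n)) grigorchuk_group"
    unfolding normally_RG_rigid_def
  proof (intro conjI exI[of _ 200] allI impI)
    show "mono (\<lambda>n. log 2 (log 2 (real n)))" "mono (\<lambda>n. log 2 (real n))"
      by (intro monoI loglog_mono nat_log_mono; assumption)+
    then show "filterlim (\<lambda>n. log 2 (log 2 (real n))) at_top sequentially"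
      "filterlim (\<lambda>n. log 2 (real n)) at_top sequentially"
    proof (rule_tac [!] mono_filterlim_at_top)
      fix k
      show "\<exists>N. real k \<le> log 2 (log 2 (real N))"
        using loglog_power[of k] by (intro exI[of _ "2 ^ 2 ^ k"]) simp
      show "\<exists>N. real k \<le> log 2 (real N)"
        by (intro exI[of _ "2 ^ k"]) (simp add: log_nat_power)
    qed
    show "finitely_generated_group grigorchuk_group"
      unfolding finitely_generated_group_def
      using group_grigorchuk_group gens_Grig generate_gens by (intro conjI exI[of _ gens]) simp_all
  next
    fix H assume H: "H \<lhd> grigorchuk_group \<and> finite_index grigorchuk_group H"
    note est = normal_subgroup_log_estimates[OF conjunct1[OF H] finite_index_imp_nontrivial]
    \<comment> \<open>The factor 200 inside makes the double logarithm at least 2, also for index 1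
      and 2; multiplied by the outer 200 it exceeds the exceptional bound 8.\<close>
    have "2 ^ 2 ^ 2 \<le> 200 * ?i H" "?i H \<le> 200 * ?i H" using est(2) H by auto
    from this[THEN loglog_mono]
    have "2 \<le> log 2 (log 2 (real (200 * ?i H)))"
      "log 2 (log 2 (real (?i H))) \<le> log 2 (log 2 (real (200 * ?i H)))"
      by (simp_all only: loglog_power of_nat_numeral)
    then show "log 2 (real (?r H)) < real 200 * log 2 (log 2 (real (200 * ?i H)))"
      using est(5) H by auto
    have "log 2 (real (?r H)) \<le> log 2 (real (200 * ?r H))"
      by (rule nat_log_mono) simp
    then show "log 2 (log 2 (real (?i H))) < real 200 * log 2 (real (200 * ?r H))"
      using est(3,4) H by auto
  qed
  show "\<exists>D::real. D > 1 \<and>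
      (\<forall>H. H \<lhd> grigorchuk_group \<and> H \<noteq> {\<one>\<^bsub>grigorchuk_group\<^esub>} \<longrightarrow>
         finite_index grigorchuk_group H \<and>
         (?i H > 2 \<longrightarrow> 1 / D * log 2 (real (?r H)) \<le> log 2 (log 2 (real (?i H)))) \<and>
         log 2 (log 2 (real (?i H))) \<le> D * log 2 (real (?r H)))"
  proof (intro exI[of _ 200] conjI allI impI)
    fix H assume "H \<lhd> grigorchuk_group \<and> H \<noteq> {\<one>\<^bsub>grigorchuk_group\<^esub>}"
    then have H: "H \<lhd> grigorchuk_group" "H \<noteq> {id}" by simp_all
    note est = normal_subgroup_log_estimates[OF H]
    show "finite_index grigorchuk_group H" by (rule est(1))
    show "log 2 (log 2 (real (?i H))) \<le> 200 * log 2 (real (?r H))"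
      using est(3,4) by linarith
    assume "?i H > 2"
    \<comment> \<open>For index at least 3 the double logarithm is at least 1/2:
      \<open>8 <= 9\<close> gives \<open>log 2 3 >= 3/2\<close>, and the square of 3/2 exceeds 2.
      This covers the exceptional bound 8, as \<open>8 / 200 <= 1 / 2\<close>.\<close>
    have "log 2 (2 ^ 3) \<le> log 2 (3 ^ 2 :: real)"
      by (subst log_le_cancel_iff) simp_all
    moreover have "log 2 (3 ^ 2 :: real) = 2 * log 2 3" "log 2 (2 ^ 3) = (3 :: real)"
      using log_nat_power[of 3 2 2] log_nat_power[of 2 2 3] by simp_all
    ultimately have l3: "3 / 2 \<le> log 2 (3 :: real)" by linarith
    have "log 2 2 \<le> log 2 ((3 / 2) ^ 2 :: real)" by (simp add: power2_eq_square)
    then have "1 / 2 \<le> log 2 (3 / 2 :: real)" by (simp add: log_nat_power)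
    also have "\<dots> \<le> log 2 (log 2 3)" using l3 by simp
    also have "\<dots> \<le> log 2 (log 2 (real (?i H)))"
      using loglog_mono[of 3 "?i H"] \<open>?i H > 2\<close> by simp
    finally show "1 / 200 * log 2 (real (?r H)) \<le> log 2 (log 2 (real (?i H)))"
      using est(5) by linarith
  qed simp
qed

end
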